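(* Let $c>0$, $D>0$, $\tau>0$, and let $f:C([-\tau,0],\mathbb{R})\to\mathbb{R}$ satisfy conditions (C1), (C2), (C3) of the context, with constants $K>0$ and $\beta>0$. Assume that the Green's function $G$ of $\mathcal{L}\phi=c\phi'''+D\phi''-c\phi'-\beta\phi$ satisfies $-G\ge 0$ on $\mathbb{R}$. Let $\overline{\phi},\underline{\phi}\in\Gamma$ be, respectively, an upper solution and a lower solution of $$c\,\phi'''(\xi)+D\,\phi''(\xi)-c\,\phi'(\xi)+f_c(\phi_\xi)=0,\qquad \xi\in\mathbb{R},\tag{W}$$ satisfying $0\le\underline{\phi}(t)\le\overline{\phi}(t)$ for all $t\in\mathbb{R}$. Then there exists at least one solution $\phi\in\Gamma$ of (W) (a monotone traveling wave solution) such that $\underline{\phi}(t)\le\phi(t)\le\overline{\phi}(t)$ for all $t\in\mathbb{R}$.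
   Context: Notation: $r=c\tau$. For $\phi\in C(\mathbb{R},\mathbb{R})$ and $\xi\in\mathbb{R}$, $\phi_\xi\in C([-r,0],\mathbb{R})$ is $\phi_\xi(s)=\phi(\xi+s)$. For $\psi\in C([-r,0],\mathbb{R})$, $f_c(\psi):=f(\psi^c)$, where $\psi^c(\theta)=\psi(c\theta)$, $\theta\in[-\tau,0]$. (Equation (W) is the profile equation for waves $u(x,t)=\phi(x+ct)$ of $u_t=Du_{xx}+u_{xxt}+f(u_t(x))$, where in the last term $u_t(x)(\theta)=u(x,t+\theta)$.) For $u\in\mathbb{R}$, $\hat u$ is the constant function equal to $u$. $BC(\mathbb{R},\mathbb{R})$ denotes bounded continuous functions with the sup norm, and $BC^3$ denotes $C^3$ functions bounded together with their derivatives up to order 3. $\Gamma$ is the set of nondecreasing $\varphi\in C(\mathbb{R},\mathbb{R})$ with $\lim_{\xi\to-\infty}\varphi(\xi)=0$ and $\lim_{\xi\to+\infty}\varphi(\xi)=K$. Conditions on the continuous functional $f:C([-\tau,0],\mathbb{R})\to\mathbb{R}$: (C1) there is $K>0$ with $f(\hat 0)=f(\hat K)=0$ and $f(\hat u)>0$ for $0<u<K$. (C2) There is $L>0$ with $|f(\phi)-f(\psi)|\le L\|\phi-\psi\|_\infty$ for all $\phi,\psi\in C([-\tau,0],\mathbb{R})$; and there is $\beta>0$ with $f_c(\phi)-f_c(\psi)+\beta(\phi(0)-\psi(0))\ge0$ for all $\phi,\psi\in C([-r,0],\mathbb{R})$ with $0\le\psi(s)\le\phi(s)\le K$ for all $s$.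 (C3) The operator $H(\phi)(\xi):=f_c(\phi_\xi)+\beta\phi(\xi)$ is continuous from $BC(\mathbb{R},[0,K])$ to $BC(\mathbb{R},\mathbb{R})$ and $\sup_{\phi\in\Gamma}\|H(\phi)\|_\infty<\infty$. The Green's function $G$ of $\mathcal{L}$ is the unique bounded continuous function on $\mathbb{R}$ with $\mathcal{L}G=\delta$ (Dirac distribution at $0$). An upper (resp. lower) solution of (W) is a function $\phi\in BC^3(\mathbb{R},\mathbb{R})$ with $c\phi'''(\xi)+D\phi''(\xi)-c\phi'(\xi)+f_c(\phi_\xi)\le0$ (resp. $\ge0$) for all $\xi\in\mathbb{R}$. *)

theory Defs
  imports "HOL-Analysis.Analysis"
begin

text \<open>
  The space of bounded continuous real functions on \<open>S\<close> with the supremum metric.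
  Its elements are extensional, i.e. equal to \<^term>\<open>undefined\<close> outside \<open>S\<close>, so that functions
  with the same values on \<open>S\<close> are identified.  For \<open>S\<close> compact it is $C(S, R)$, and for
  \<open>S = UNIV\<close> it is $BC(R, R)$.
\<close>
definition BC :: "real set \<Rightarrow> (real \<Rightarrow> real) metric" where
  "BC S = cfunspace (top_of_set S) euclidean_metric"

lemma mspace_BC:
  "mspace (BC S) = {\<phi>. continuous_on S \<phi> \<and> bounded (\<phi> ` S) \<and> \<phi> \<in> extensional S}"
proof -
  have "Metric_space.mbounded (UNIV :: real set) dist T \<longleftrightarrow> bounded T" for T
    by (simp add: Met_TC.mbounded_def bounded_def subset_iff)
  then show ?thesis
    by (auto simp: BC_def)
qed

lemma mdist_BC_le:
  assumes "\<phi> \<in> mspace (BC S)" "\<psi> \<in> mspace (BC S)" "S \<noteq> {}"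
  shows "mdist (BC S) \<phi> \<psi> \<le> a \<longleftrightarrow> (\<forall>x\<in>S. \<bar>\<phi> x - \<psi> x\<bar> \<le> a)"
  using assms cfunspace_mdist_le[of \<phi> "top_of_set S" euclidean_metric \<psi> a]
  by (simp add: BC_def dist_real_def)

text \<open>The functional \<open>f\<close> lives on \<^term>\<open>mspace (BC {-\<tau>..0})\<close>; only its values there matter.\<close>

definition hat :: "real \<Rightarrow> real \<Rightarrow> real \<Rightarrow> real" where
  "hat \<tau> u = restrict (\<lambda>_. u) {-\<tau>..0}"

definition fc :: "((real \<Rightarrow> real) \<Rightarrow> real) \<Rightarrow> real \<Rightarrow> real \<Rightarrow> (real \<Rightarrow> real) \<Rightarrow> real" where
  "fc f c \<tau> \<psi> = f (restrict (\<lambda>\<theta>. \<psi> (c * \<theta>)) {-\<tau>..0})"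

definition seg :: "real \<Rightarrow> (real \<Rightarrow> real) \<Rightarrow> real \<Rightarrow> real \<Rightarrow> real" where
  "seg r \<phi> \<xi> = restrict (\<lambda>s. \<phi> (\<xi> + s)) {-r..0}"

definition Gam :: "real \<Rightarrow> (real \<Rightarrow> real) set" where
  "Gam K = {\<phi>. continuous_on UNIV \<phi> \<and> mono \<phi> \<and> (\<phi> \<longlongrightarrow> 0) at_bot \<and> (\<phi> \<longlongrightarrow> K) at_top}"

definition cond_C1 :: "((real \<Rightarrow> real) \<Rightarrow> real) \<Rightarrow> real \<Rightarrow> real \<Rightarrow> bool" where
  "cond_C1 f \<tau> K \<longleftrightarrow>
     K > 0 \<and> f (hat \<tau> 0) = 0 \<and> f (hat \<tau> K) = 0 \<and> (\<forall>u. 0 < u \<and> u < K \<longrightarrow> f (hat \<tau> u) > 0)"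

definition cond_C2 ::
  "((real \<Rightarrow> real) \<Rightarrow> real) \<Rightarrow> real \<Rightarrow> real \<Rightarrow> real \<Rightarrow> real \<Rightarrow> bool" where
  "cond_C2 f c \<tau> K \<beta> \<longleftrightarrow>
     (\<exists>L>0. \<forall>\<phi>\<in>mspace (BC {-\<tau>..0}). \<forall>\<psi>\<in>mspace (BC {-\<tau>..0}).
        \<bar>f \<phi> - f \<psi>\<bar> \<le> L * mdist (BC {-\<tau>..0}) \<phi> \<psi>) \<and>
     \<beta> > 0 \<and>
     (\<forall>\<phi>\<in>mspace (BC {-(c * \<tau>)..0}). \<forall>\<psi>\<in>mspace (BC {-(c * \<tau>)..0}).
        (\<forall>s\<in>{-(c * \<tau>)..0}. 0 \<le> \<psi> s \<and> \<psi> s \<le> \<phi> s \<and> \<phi> s \<le> K) \<longrightarrow>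
        fc f c \<tau> \<phi> - fc f c \<tau> \<psi> + \<beta> * (\<phi> 0 - \<psi> 0) \<ge> 0)"

definition Hop ::
  "((real \<Rightarrow> real) \<Rightarrow> real) \<Rightarrow> real \<Rightarrow> real \<Rightarrow> real \<Rightarrow> (real \<Rightarrow> real) \<Rightarrow> real \<Rightarrow> real" where
  "Hop f c \<tau> \<beta> \<phi> \<xi> = fc f c \<tau> (seg (c * \<tau>) \<phi> \<xi>) + \<beta> * \<phi> \<xi>"

text \<open>In \<open>cond_C3\<close> the sup norm is the distance to the zero function.\<close>
definition cond_C3 ::
  "((real \<Rightarrow> real) \<Rightarrow> real) \<Rightarrow> real \<Rightarrow> real \<Rightarrow> real \<Rightarrow> real \<Rightarrow> bool" where
  "cond_C3 f c \<tau> K \<beta> \<longleftrightarrow>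
     continuous_map (mtopology_of (submetric (BC UNIV) {\<phi>. \<forall>\<xi>. 0 \<le> \<phi> \<xi> \<and> \<phi> \<xi> \<le> K}))
       (mtopology_of (BC UNIV)) (Hop f c \<tau> \<beta>) \<and>
     bdd_above ((\<lambda>\<phi>. mdist (BC UNIV) (Hop f c \<tau> \<beta> \<phi>) (\<lambda>_. 0)) ` Gam K)"

definition C_k :: "nat \<Rightarrow> (real \<Rightarrow> real) \<Rightarrow> bool" where
  "C_k k \<phi> \<longleftrightarrow>
     (\<forall>j<k. (deriv ^^ j) \<phi> differentiable_on UNIV) \<and> continuous_on UNIV ((deriv ^^ k) \<phi>)"

definition BC_k :: "nat \<Rightarrow> (real \<Rightarrow> real) \<Rightarrow> bool" where
  "BC_k k \<phi> \<longleftrightarrow> C_k k \<phi> \<and> (\<forall>j\<le>k. bounded (range ((deriv ^^ j) \<phi>)))"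

definition W_lhs ::
  "((real \<Rightarrow> real) \<Rightarrow> real) \<Rightarrow> real \<Rightarrow> real \<Rightarrow> real \<Rightarrow> (real \<Rightarrow> real) \<Rightarrow> real \<Rightarrow> real" where
  "W_lhs f c D \<tau> \<phi> \<xi> =
     c * (deriv ^^ 3) \<phi> \<xi> + D * (deriv ^^ 2) \<phi> \<xi> - c * deriv \<phi> \<xi> + fc f c \<tau> (seg (c * \<tau>) \<phi> \<xi>)"

definition W_solution ::
  "((real \<Rightarrow> real) \<Rightarrow> real) \<Rightarrow> real \<Rightarrow> real \<Rightarrow> real \<Rightarrow> (real \<Rightarrow> real) \<Rightarrow> bool" where
  "W_solution f c D \<tau> \<phi> \<longleftrightarrow> C_k 3 \<phi> \<and> (\<forall>\<xi>. W_lhs f c D \<tau> \<phi> \<xi> = 0)"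

definition W_upper_solution ::
  "((real \<Rightarrow> real) \<Rightarrow> real) \<Rightarrow> real \<Rightarrow> real \<Rightarrow> real \<Rightarrow> (real \<Rightarrow> real) \<Rightarrow> bool" where
  "W_upper_solution f c D \<tau> \<phi> \<longleftrightarrow> BC_k 3 \<phi> \<and> (\<forall>\<xi>. W_lhs f c D \<tau> \<phi> \<xi> \<le> 0)"

definition W_lower_solution ::
  "((real \<Rightarrow> real) \<Rightarrow> real) \<Rightarrow> real \<Rightarrow> real \<Rightarrow> real \<Rightarrow> (real \<Rightarrow> real) \<Rightarrow> bool" where
  "W_lower_solution f c D \<tau> \<phi> \<longleftrightarrow> BC_k 3 \<phi> \<and> (\<forall>\<xi>. W_lhs f c D \<tau> \<phi> \<xi> \<ge> 0)"

text \<open>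
  The equation $L G = \delta$ is read in the sense of distributions: a distribution is represented
  by the functional it induces on the test functions, and its derivative is given by
  $T'(\eta) = -T(\eta')$.
\<close>

definition test_function :: "(real \<Rightarrow> real) \<Rightarrow> bool" where
  "test_function \<eta> \<longleftrightarrow> (\<forall>k. C_k k \<eta>) \<and> compact (closure {x. \<eta> x \<noteq> 0})"

definition regular_distr :: "(real \<Rightarrow> real) \<Rightarrow> (real \<Rightarrow> real) \<Rightarrow> real" where
  "regular_distr G \<eta> = (LINT x|lborel. G x * \<eta> x)"

definition distr_deriv :: "((real \<Rightarrow> real) \<Rightarrow> real) \<Rightarrow> (real \<Rightarrow> real) \<Rightarrow> real" where
  "distr_deriv T \<eta> = - T (deriv \<eta>)"

definition distr_L ::
  "real \<Rightarrow> real \<Rightarrow> real \<Rightarrow> ((real \<Rightarrow> real) \<Rightarrow> real) \<Rightarrow> (real \<Rightarrow> real) \<Rightarrow> real" where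
  "distr_L c D \<beta> T \<eta> =
     c * (distr_deriv ^^ 3) T \<eta> + D * (distr_deriv ^^ 2) T \<eta> - c * distr_deriv T \<eta> - \<beta> * T \<eta>"

text \<open>
  For \<open>c, D, \<beta> > 0\<close> the symbol of the operator has no zero on the imaginary axis, so exactly one
  function satisfies this predicate.
\<close>
definition is_Green_function :: "real \<Rightarrow> real \<Rightarrow> real \<Rightarrow> (real \<Rightarrow> real) \<Rightarrow> bool" where
  "is_Green_function c D \<beta> G \<longleftrightarrow>
     continuous_on UNIV G \<and> bounded (range G) \<and>
     (\<forall>\<eta>. test_function \<eta> \<longrightarrow> distr_L c D \<beta> (regular_distr G) \<eta> = \<eta> 0)"

end

theory Submission
  imports Defs
begin

text \<open>
  If \<open>-G \<ge> 0\<close>, then all roots of \<open>c z\<^sup>3 + D z\<^sup>2 - c z - \<beta>\<close> are real: one is positive, and a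
  complex pair would make \<open>G\<close> oscillate on the positive half-line.  Hence \<open>L\<close> is a product of
  three real first-order operators, whose bounded inverses are explicit and have a sign.  So
  \<open>L u = -h\<close> has a bounded solution for every bounded continuous \<open>h\<close>, and the solution is unique,
  monotone in \<open>h\<close>, Lipschitz with a constant controlled by \<open>\<parallel>h\<parallel>\<close>, and bounded by \<open>\<parallel>h\<parallel> / \<beta>\<close>.

  Since \<open>H\<close> is monotone, iterating \<open>\<phi> \<mapsto> -L\<inverse> H(\<phi>)\<close> from the upper solution gives a decreasing,
  equi-Lipschitz sequence of nondecreasing functions above the lower solution.  The upper and the
  lower solution have the same limits at \<open>\<plusminus>\<infinity>\<close>, so together with Dini's theorem the convergence is
  uniform on the whole line, the limit is a fixed point, and it has the right limits.
\<close>

section \<open>Smooth bump functions\<close>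

lemma C_k_0: "C_k 0 f \<longleftrightarrow> continuous_on UNIV f"
  by (simp add: C_k_def)

text \<open>Peeling off the innermost derivative, rather than the outermost one, lets closure
  properties of \<open>C_k\<close> be proved by induction on \<open>k\<close> with the functions
  generalised.\<close>

lemma C_k_Suc: "C_k (Suc k) f \<longleftrightarrow> (\<forall>x. f differentiable at x) \<and> C_k k (deriv f)"
  unfolding C_k_def All_less_Suc2 funpow_Suc_right o_apply
  by (simp add: differentiable_on_def)

lemma C_k_SucI:
  assumes "\<And>x. (f has_real_derivative f' x) (at x)" "C_k k f'"
  shows "C_k (Suc k) f"
proof -
  have "deriv f = f'"
    using assms(1) by (auto intro: DERIV_imp_deriv)
  then show ?thesis
    using assms by (auto simp: C_k_Suc real_differentiable_def)
qed

lemma C_k_Suc_deriv: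
  assumes "C_k (Suc k) f"
  shows "(f has_real_derivative deriv f x) (at x)"
  using assms by (auto simp: C_k_Suc DERIV_deriv_iff_real_differentiable)

lemma C_k_SucD: "C_k (Suc k) f \<Longrightarrow> C_k k f"
  by (auto simp: C_k_def differentiable_imp_continuous_on)

lemma C_k_const: "C_k k (\<lambda>_. a)"
  by (induction k arbitrary: a) (auto simp: C_k_0 intro: C_k_SucI[where f' = "\<lambda>_. 0"])

lemma C_k_add: "C_k k f \<Longrightarrow> C_k k g \<Longrightarrow> C_k k (\<lambda>x. f x + g x)"
proof (induction k arbitrary: f g)
  case 0
  then show ?case by (auto simp: C_k_0 intro: continuous_intros)
next
  case (Suc k)
  show ?case
  proof (rule C_k_SucI)
    show "((\<lambda>x. f x + g x) has_real_derivative deriv f x + deriv g x) (at x)" for x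
      by (rule DERIV_add[OF C_k_Suc_deriv[OF Suc.prems(1)] C_k_Suc_deriv[OF Suc.prems(2)]])
    show "C_k k (\<lambda>x. deriv f x + deriv g x)"
      using Suc.prems by (intro Suc.IH) (auto simp: C_k_Suc)
  qed
qed

lemma C_k_mult: "C_k k f \<Longrightarrow> C_k k g \<Longrightarrow> C_k k (\<lambda>x. f x * g x)"
proof (induction k arbitrary: f g)
  case 0
  then show ?case by (auto simp: C_k_0 intro: continuous_intros)
next
  case (Suc k)
  show ?case
  proof (rule C_k_SucI)
    show "((\<lambda>x. f x * g x) has_real_derivative deriv f x * g x + deriv g x * f x) (at x)" for x
      by (rule DERIV_mult[OF C_k_Suc_deriv[OF Suc.prems(1)] C_k_Suc_deriv[OF Suc.prems(2)]])
    show "C_k k (\<lambda>x. deriv f x * g x + deriv g x * f x)"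
      using Suc.prems Suc.prems[THEN C_k_SucD] by (intro C_k_add Suc.IH) (auto simp: C_k_Suc)
  qed
qed

lemma C_k_affine: "C_k k f \<Longrightarrow> C_k k (\<lambda>x. f (a * x + b))"
proof (induction k arbitrary: f)
  case 0
  then show ?case
    unfolding C_k_0 by (rule continuous_on_compose2) (auto intro!: continuous_intros)
next
  case (Suc k)
  show ?case
  proof (rule C_k_SucI)
    show "((\<lambda>x. f (a * x + b)) has_real_derivative deriv f (a * x + b) * a) (at x)" for x
      by (rule DERIV_chain2[OF C_k_Suc_deriv[OF Suc.prems]]) (auto intro!: derivative_eq_intros)
    show "C_k k (\<lambda>x. deriv f (a * x + b) * a)"
      using Suc.prems by (intro C_k_mult C_k_const Suc.IH) (auto simp: C_k_Suc)
  qed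
qed

text \<open>\<open>flat 1\<close> is the classical smooth function \<open>exp (- 1 / x)\<close>
  continued by 0. The polynomial factor in \<open>1 / x\<close> makes the family closed under
  differentiation, so smoothness of every order follows by induction.\<close>

definition flat :: "real poly \<Rightarrow> real \<Rightarrow> real" where
  "flat p x = (if x > 0 then poly p (1 / x) * exp (- (1 / x)) else 0)"

lemma poly_times_exp_tendsto_0: "((\<lambda>y. poly p y * exp (- y)) \<longlongrightarrow> 0) at_top" for p :: "real poly"
proof -
  have "((\<lambda>y. \<Sum>i\<le>degree p. coeff p i * (y ^ i / exp y)) \<longlongrightarrow> (\<Sum>i\<le>degree p. coeff p i * 0)) at_top"
    by (intro tendsto_intros tendsto_power_div_exp_0)
  then show ?thesis
    by (simp add: poly_altdef sum_distrib_right exp_minus divide_inverse mult.assoc)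
qed

lemma flat_tendsto_0: "(flat p \<longlongrightarrow> 0) (at 0)"
proof -
  have "((\<lambda>x. poly p (1 / x) * exp (- (1 / x))) \<longlongrightarrow> 0) (at_right 0)"
    using filterlim_compose[OF poly_times_exp_tendsto_0 filterlim_inverse_at_top_right]
    by (simp add: inverse_eq_divide)
  then have "(flat p \<longlongrightarrow> 0) (at_right 0)"
    by (rule Lim_transform_eventually) (auto simp: eventually_at_filter flat_def)
  moreover have "(flat p \<longlongrightarrow> 0) (at_left 0)"
    by (rule Lim_transform_eventually[OF tendsto_const]) (auto simp: eventually_at_filter flat_def)
  ultimately show ?thesis
    by (simp add: filterlim_split_at)
qed

text \<open>For \<open>x > 0\<close> the product rule produces the factor \<open>1 / x^2\<close>,
  which is the polynomial \<open>[:0, 0, 1:]\<close> at \<open>1 / x\<close>. At 0 the decay of the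
  exponential gives derivative 0.\<close>

lemma DERIV_flat: "(flat p has_real_derivative flat ([:0, 0, 1:] * (p - pderiv p)) x) (at x)"
proof -
  consider "x > 0" | "x < 0" | "x = 0" by linarith
  then show ?thesis
  proof cases
    case 1
    have "((\<lambda>x. poly p (1 / x) * exp (- (1 / x))) has_real_derivative
        flat ([:0, 0, 1:] * (p - pderiv p)) x) (at x)"
      using 1 by (auto intro!: derivative_eq_intros DERIV_chain2[OF poly_DERIV]
          simp: flat_def power2_eq_square field_simps)
    then show ?thesis
      by (rule has_field_derivative_transform_within_open[where S = "{0<..}"])
        (use 1 in \<open>auto simp: flat_def\<close>)
  next
    case 2
    have "((\<lambda>x. 0) has_real_derivative flat ([:0, 0, 1:] * (p - pderiv p)) x) (at x)"
      using 2 by (simp add: flat_def)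
    then show ?thesis
      by (rule has_field_derivative_transform_within_open[where S = "{..<0}"])
        (use 2 in \<open>auto simp: flat_def\<close>)
  next
    case 3
    \<comment> \<open>Dividing by \<open>h\<close> multiplies the polynomial by one more power of
      \<open>1 / h\<close>, so the difference quotient at 0 stays in the family and tends to
      0.\<close>
    have "(\<lambda>h. (flat p (0 + h) - flat p 0) / h) = flat ([:0, 1:] * p)"
      by (auto simp: flat_def fun_eq_iff)
    then show ?thesis
      using flat_tendsto_0[of "[:0, 1:] * p"] 3 by (simp add: DERIV_def flat_def)
  qed
qed

lemma C_k_flat: "C_k k (flat p)"
proof (induction k arbitrary: p)
  case 0
  then show ?case
    by (auto simp: C_k_0 continuous_on_eq_continuous_at intro: DERIV_isCont[OF DERIV_flat])
next
  case (Suc k)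
  then show ?case by (rule C_k_SucI[OF DERIV_flat])
qed

lemma exists_bump:
  assumes "\<delta> > 0"
  obtains \<rho> where "\<And>k. C_k k \<rho>" "\<And>x. 0 \<le> \<rho> x" "0 < \<rho> 0" "\<And>x. \<delta> \<le> \<bar>x\<bar> \<Longrightarrow> \<rho> x = 0"
proof
  \<comment> \<open>A flat function times a mirror image of it, positive exactly between
    \<open>- \<delta>\<close> and \<open>\<delta>\<close>. The factors \<open>1\<close> and
    \<open>- 1\<close> match the form of \<open>C_k_affine\<close>.\<close>
  define \<rho> where "\<rho> x = flat 1 (1 * x + \<delta>) * flat 1 (- 1 * x + \<delta>)" for x
  show "C_k k \<rho>" for k
    unfolding \<rho>_def by (intro C_k_mult C_k_affine C_k_flat)
  show "0 \<le> \<rho> x" "0 < \<rho> 0" "\<delta> \<le> \<bar>x\<bar> \<Longrightarrow> \<rho> x = 0" for x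
    using assms by (auto simp: \<rho>_def flat_def)
qed

section \<open>Mollification of the Green's function\<close>

lemma deriv_eq_0_outside:
  assumes "\<And>x. \<delta> < \<bar>x\<bar> \<Longrightarrow> f x = 0" "\<delta> < \<bar>x\<bar>"
  shows "deriv f x = (0::real)"
proof (rule DERIV_imp_deriv, rule has_field_derivative_transform_within_open)
  show "((\<lambda>_. 0) has_real_derivative 0) (at x)" by simp
  show "open {x. \<delta> < \<bar>x\<bar>}"
    by (intro open_Collect_less continuous_intros)
qed (use assms in auto)

lemma test_functionI:
  assumes "\<And>k. C_k k \<eta>" "\<And>x. \<delta> < \<bar>x - x0\<bar> \<Longrightarrow> \<eta> x = 0"
  shows "test_function \<eta>"
proof -
  have "{x. \<eta> x \<noteq> 0} \<subseteq> cball x0 \<delta>"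
    using assms(2) by (force simp: dist_real_def abs_minus_commute)
  then have "bounded {x. \<eta> x \<noteq> 0}"
    using bounded_cball bounded_subset by blast
  then show ?thesis
    using assms(1) by (simp add: test_function_def compact_closure)
qed

text \<open>Compact support turns the integral over the line into one over an interval, where the
  Leibniz rule and simple bounds apply. The interval is left free so that one choice can serve many
  \<open>x\<close>.\<close>

lemma LINT_convolution:
  fixes G \<sigma> :: "real \<Rightarrow> real"
  assumes "continuous_on UNIV G" "continuous_on UNIV \<sigma>" "\<And>x. \<delta> < \<bar>x\<bar> \<Longrightarrow> \<sigma> x = 0"
    and "\<alpha> \<le> x - \<delta>" "x + \<delta> \<le> \<gamma>"
  shows "(LINT y|lborel. G y * \<sigma> (x - y)) = integral {\<alpha>..\<gamma>} (\<lambda>y. G y * \<sigma> (x - y))"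
proof -
  have "continuous_on {\<alpha>..\<gamma>} (\<lambda>y. G y * \<sigma> (x - y))"
    by (intro continuous_intros continuous_on_subset[OF assms(1)] continuous_on_compose2[OF assms(2)]) auto
  then have "(LINT y:{\<alpha>..\<gamma>}|lborel. G y * \<sigma> (x - y)) = integral {\<alpha>..\<gamma>} (\<lambda>y. G y * \<sigma> (x - y))"
    by (intro set_borel_integral_eq_integral borel_integrable_atLeastAtMost')
  moreover have "(LINT y:{\<alpha>..\<gamma>}|lborel. G y * \<sigma> (x - y)) = (LINT y|lborel. G y * \<sigma> (x - y))"
    unfolding set_lebesgue_integral_def
  proof (intro Bochner_Integration.integral_cong refl)
    show "indicat_real {\<alpha>..\<gamma>} y *\<^sub>R (G y * \<sigma> (x - y)) = G y * \<sigma> (x - y)" for y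
    proof (cases "y \<in> {\<alpha>..\<gamma>}")
      case False
      then have "\<delta> < \<bar>x - y\<bar>"
        using assms(4,5) by auto
      then show ?thesis
        by (simp add: assms(3))
    qed auto
  qed
  ultimately show ?thesis by simp
qed

text \<open>Differentiation under the integral, with every derivative falling on the smooth factor;
  \<open>G\<close> is merely continuous.\<close>

lemma DERIV_LINT_convolution:
  fixes G \<sigma> \<sigma>' :: "real \<Rightarrow> real"
  assumes G: "continuous_on UNIV G" and \<sigma>: "\<And>x. (\<sigma> has_real_derivative \<sigma>' x) (at x)"
    and \<sigma>': "continuous_on UNIV \<sigma>'"
    and supp: "\<And>x. \<delta> < \<bar>x\<bar> \<Longrightarrow> \<sigma> x = 0" "\<And>x. \<delta> < \<bar>x\<bar> \<Longrightarrow> \<sigma>' x = 0"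
  shows "((\<lambda>x. LINT y|lborel. G y * \<sigma> (x - y)) has_real_derivative
    (LINT y|lborel. G y * \<sigma>' (x0 - y))) (at x0)"
proof -
  \<comment> \<open>This interval contains the support of
    \<open>y \<mapsto> \<sigma> (x - y)\<close> for every \<open>x\<close> within distance 1 of
    \<open>x0\<close>, so the domain of integration does not depend on \<open>x\<close>.\<close>
  define \<alpha> \<gamma> where "\<alpha> = x0 - 1 - \<delta>" and "\<gamma> = x0 + 1 + \<delta>"
  have c\<sigma>: "continuous_on UNIV \<sigma>"
    using \<sigma> DERIV_isCont by (auto simp: continuous_on_eq_continuous_at)
  have eq: "(LINT y|lborel. G y * \<sigma> (x - y)) = integral (cbox \<alpha> \<gamma>) (\<lambda>y. G y * \<sigma> (x - y))"
    "(LINT y|lborel. G y * \<sigma>' (x - y)) = integral (cbox \<alpha> \<gamma>) (\<lambda>y. G y * \<sigma>' (x - y))"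
    if "x \<in> {x0-1..x0+1}" for x
    using that LINT_convolution[OF G c\<sigma> supp(1), where \<alpha>=\<alpha> and \<gamma>=\<gamma>]
      LINT_convolution[OF G \<sigma>' supp(2), where \<alpha>=\<alpha> and \<gamma>=\<gamma>]
    by (auto simp: \<alpha>_def \<gamma>_def)
  have "((\<lambda>x. integral (cbox \<alpha> \<gamma>) (\<lambda>y. G y * \<sigma> (x - y))) has_real_derivative
      integral (cbox \<alpha> \<gamma>) (\<lambda>y. G y * \<sigma>' (x0 - y))) (at x0 within {x0-1..x0+1})"
  proof (rule leibniz_rule_field_derivative)
    show "((\<lambda>x. G y * \<sigma> (x - y)) has_real_derivative G y * \<sigma>' (x - y)) (at x within {x0-1..x0+1})" for x y
      by (auto intro!: derivative_eq_intros DERIV_chain2[OF \<sigma>] intro: has_field_derivative_at_within)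
    show "(\<lambda>y. G y * \<sigma> (x - y)) integrable_on cbox \<alpha> \<gamma>" for x
      by (intro integrable_continuous continuous_intros continuous_on_subset[OF G]
          continuous_on_compose2[OF c\<sigma>]) auto
    show "continuous_on ({x0-1..x0+1} \<times> cbox \<alpha> \<gamma>) (\<lambda>(x, y). G y * \<sigma>' (x - y))"
      unfolding split_beta
      by (intro continuous_intros continuous_on_compose2[OF G] continuous_on_compose2[OF \<sigma>']) auto
  qed auto
  then have "((\<lambda>x. integral (cbox \<alpha> \<gamma>) (\<lambda>y. G y * \<sigma> (x - y))) has_real_derivative
      integral (cbox \<alpha> \<gamma>) (\<lambda>y. G y * \<sigma>' (x0 - y))) (at x0)"
    by (simp add: at_within_Icc_at)
  then have "((\<lambda>x. integral (cbox \<alpha> \<gamma>) (\<lambda>y. G y * \<sigma> (x - y))) has_real_derivative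
      (LINT y|lborel. G y * \<sigma>' (x0 - y))) (at x0)"
    using eq(2)[of x0] by simp
  then show ?thesis
    by (rule has_field_derivative_transform_within_open[where S = "{x0-1<..<x0+1}"])
      (auto simp: eq)
qed

lemma bounded_LINT_convolution:
  fixes G \<sigma> :: "real \<Rightarrow> real"
  assumes G: "continuous_on UNIV G" "bounded (range G)" and \<sigma>: "continuous_on UNIV \<sigma>"
    and supp: "\<And>x. \<delta> < \<bar>x\<bar> \<Longrightarrow> \<sigma> x = 0" and "\<delta> > 0"
  shows "bounded (range (\<lambda>x. LINT y|lborel. G y * \<sigma> (x - y)))"
proof -
  obtain M where M: "\<And>x. \<bar>G x\<bar> \<le> M"
    using G(2) by (auto simp: bounded_iff)
  have "bounded (\<sigma> ` {-\<delta>..\<delta>})"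
    by (intro compact_imp_bounded compact_continuous_image continuous_on_subset[OF \<sigma>]) auto
  then obtain N where N: "\<And>x. x \<in> {-\<delta>..\<delta>} \<Longrightarrow> \<bar>\<sigma> x\<bar> \<le> N"
    unfolding bounded_iff by (metis imageI real_norm_def)
  have "\<bar>LINT y|lborel. G y * \<sigma> (x - y)\<bar> \<le> M * N * (2 * \<delta>)" for x
  proof -
    have "norm (integral {x-\<delta>..x+\<delta>} (\<lambda>y. G y * \<sigma> (x - y))) \<le> M * N * (x + \<delta> - (x - \<delta>))"
    proof (rule integral_bound)
      show "continuous_on {x-\<delta>..x+\<delta>} (\<lambda>y. G y * \<sigma> (x - y))"
        by (intro continuous_intros continuous_on_subset[OF G(1)] continuous_on_compose2[OF \<sigma>]) auto
      show "norm (G y * \<sigma> (x - y)) \<le> M * N" if "y \<in> {x-\<delta>..x+\<delta>}" for y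
        using that M[of y] N[of "x - y"] by (auto simp: abs_mult intro!: mult_mono order_trans[OF abs_ge_zero M])
    qed (use \<open>\<delta> > 0\<close> in auto)
    then show ?thesis
      using LINT_convolution[OF G(1) \<sigma> supp, where \<alpha>="x-\<delta>" and \<gamma>="x+\<delta>" and x=x] by simp
  qed
  then show ?thesis
    by (auto simp: bounded_iff)
qed

text \<open>Convolving the distributional identity \<open>L G = \<delta>\<close> with a bump \<open>\<rho>\<close> turns it into a classical
  differential equation with right-hand side \<open>\<rho>\<close>.\<close>
lemma Green_function_mollified:
  assumes G: "is_Green_function c D \<beta> G" and "\<And>x. G x \<le> 0" and "\<delta> > 0"
  obtains \<rho> u u1 u2 u3 where
    "\<And>x. 0 \<le> \<rho> x" "0 < \<rho> 0" "\<And>x. \<delta> \<le> \<bar>x\<bar> \<Longrightarrow> \<rho> x = 0"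
    "\<And>x. (u has_real_derivative u1 x) (at x)" "\<And>x. (u1 has_real_derivative u2 x) (at x)"
    "\<And>x. (u2 has_real_derivative u3 x) (at x)"
    "bounded (range u)" "bounded (range u1)" "bounded (range u2)" "\<And>x. u x \<le> 0"
    "\<And>x. c * u3 x + D * u2 x - c * u1 x - \<beta> * u x = \<rho> x"
proof -
  obtain \<rho> where \<rho>: "\<And>k. C_k k \<rho>" "\<And>x. 0 \<le> \<rho> x" "0 < \<rho> 0" "\<And>x. \<delta> \<le> \<bar>x\<bar> \<Longrightarrow> \<rho> x = 0"
    using exists_bump[OF \<open>\<delta> > 0\<close>] by blast
  define \<sigma> where "\<sigma> k = (deriv ^^ k) \<rho>" for k
  have \<sigma>_0: "\<sigma> 0 = \<rho>" by (simp add: \<sigma>_def)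
  have C: "C_k n (\<sigma> k)" for n k
  proof (induction k arbitrary: n)
    case 0
    then show ?case using \<rho>(1) by (simp add: \<sigma>_def)
  next
    case (Suc k)
    from Suc[of "Suc n"] show ?case by (simp add: \<sigma>_def C_k_Suc)
  qed
  have cont: "continuous_on UNIV (\<sigma> k)" for k
    using C[of 0] by (simp add: C_k_0)
  have d: "(\<sigma> k has_real_derivative \<sigma> (Suc k) x) (at x)" for k x
    using C_k_Suc_deriv[OF C, of k x] by (simp add: \<sigma>_def)
  have supp: "\<delta> < \<bar>x\<bar> \<Longrightarrow> \<sigma> k x = 0" for k x
  proof (induction k arbitrary: x)
    case 0
    then show ?case using \<rho>(4) by (simp add: \<sigma>_def)
  next
    case (Suc k)
    then show ?case
      using deriv_eq_0_outside[of \<delta> "\<sigma> k" x] by (simp add: \<sigma>_def)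
  qed
  have cG: "continuous_on UNIV G" and bG: "bounded (range G)"
    using G by (auto simp: is_Green_function_def)
  define U where "U k x = (LINT y|lborel. G y * \<sigma> k (x - y))" for k x
  have dU: "(U k has_real_derivative U (Suc k) x) (at x)" for k x
    unfolding U_def[abs_def] by (rule DERIV_LINT_convolution[OF cG d cont supp supp])
  have bU: "bounded (range (U k))" for k
    unfolding U_def[abs_def] by (rule bounded_LINT_convolution[OF cG bG cont supp \<open>\<delta> > 0\<close>])
  have "U 0 x \<le> 0" for x
  proof -
    have "0 \<le> (LINT y|lborel. - (G y * \<sigma> 0 (x - y)))"
      by (rule Bochner_Integration.integral_nonneg)
        (use \<rho>(2) assms(2) \<sigma>_0 in \<open>auto simp: mult_le_0_iff\<close>)
    then show ?thesis by (simp add: U_def)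
  qed
  moreover have "c * U 3 x + D * U 2 x - c * U 1 x - \<beta> * U 0 x = \<rho> x" for x
  proof -
    \<comment> \<open>The \<open>k\<close>-th derivative of the test function
      \<open>y \<mapsto> \<rho> (x - y)\<close>, whose value at 0 is \<open>\<rho> x\<close>. Its
      sign cancels against the signs from \<open>distr_deriv\<close>.\<close>
    define \<eta> where "\<eta> k y = (- 1) ^ k * \<sigma> k (x - y)" for k y
    have d\<eta>: "deriv (\<eta> k) = \<eta> (Suc k)" for k
    proof (rule ext, rule DERIV_imp_deriv)
      show "(\<eta> k has_real_derivative \<eta> (Suc k) y) (at y)" for y
        unfolding \<eta>_def[abs_def] by (auto intro!: derivative_eq_intros DERIV_chain2[OF d])
    qed
    have "test_function (\<eta> 0)"
    proof (rule test_functionI[of "\<eta> 0" \<delta> x])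
      show "C_k k (\<eta> 0)" for k
        using C_k_affine[OF C, of k 0 "- 1" x] by (simp add: \<eta>_def[abs_def])
    qed (use supp in \<open>auto simp: \<eta>_def abs_minus_commute\<close>)
    then have "distr_L c D \<beta> (regular_distr G) (\<eta> 0) = \<eta> 0 0"
      using G by (simp add: is_Green_function_def)
    moreover have "regular_distr G (\<eta> k) = (- 1) ^ k * U k x" for k
      unfolding regular_distr_def U_def \<eta>_def
      by (simp add: mult.left_commute[of "G _" "(-1) ^ k"])
    ultimately show ?thesis
      by (simp add: distr_L_def distr_deriv_def d\<eta> numeral_3_eq_3 numeral_2_eq_2 \<eta>_def \<sigma>_0)
  qed
  ultimately show thesis
    using that[of \<rho> "U 0" "U 1" "U 2" "U 3"] \<rho> dU[of 0] dU[of 1] dU[of 2] bU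
    by (simp add: numeral_3_eq_3 numeral_2_eq_2)
qed

section \<open>The sign of the Green's function and the characteristic roots\<close>

text \<open>A shift by the half period \<open>pi / b\<close> reverses the sign, so the function is
  both nonpositive and nonnegative. A multiple of the period and a quarter period after it then give
  \<open>q\<close> and \<open>p\<close>.\<close>

lemma sinusoid_nonpos_imp_0:
  fixes p q b :: real
  assumes "b > 0" and s: "\<And>x. \<delta> \<le> x \<Longrightarrow> p * sin (b * x) + q * cos (b * x) \<le> 0"
  shows "p = 0" "q = 0"
proof -
  have eq: "p * sin (b * x) + q * cos (b * x) = 0" if "\<delta> \<le> x" for x
  proof -
    have "b * (x + pi / b) = b * x + pi"
      using \<open>b > 0\<close> by (simp add: field_simps)
    then show ?thesis
      using s[OF that] s[of "x + pi / b"] that \<open>b > 0\<close> by (simp add: add_increasing2)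
  qed
  obtain n :: nat where "\<delta> * b / (2 * pi) \<le> n"
    using real_arch_simple by blast
  then have n: "\<delta> \<le> 2 * pi * n / b"
    using \<open>b > 0\<close> by (simp add: field_simps)
  also have "\<dots> \<le> (2 * pi * n + pi / 2) / b"
    using \<open>b > 0\<close> by (intro divide_right_mono) auto
  finally have n': "\<delta> \<le> (2 * pi * n + pi / 2) / b" .
  have "sin (2 * pi * real n) = 0" "cos (2 * pi * real n) = 1"
    using sin_2npi[of n] cos_2npi[of n] by (simp_all add: mult.commute mult.left_commute)
  then show "p = 0" "q = 0"
    using eq[OF n] eq[OF n'] \<open>b > 0\<close> by (auto simp: sin_add cos_add)
qed

lemma has_vector_derivative_0_imp_eq:
  fixes F :: "real \<Rightarrow> 'a::real_normed_vector"
  assumes F: "\<And>x. \<delta> \<le> x \<Longrightarrow> (F has_vector_derivative 0) (at x)" and "\<delta> \<le> x"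
  shows "F x = F \<delta>"
proof -
  have "(F has_vector_derivative 0) (at y within {\<delta>..})" if "y \<in> {\<delta>..}" for y
    using F[of y] that by (simp add: has_vector_derivative_at_within)
  then obtain k where "\<forall>y\<in>{\<delta>..}. F y = k"
    using has_vector_derivative_zero_constant[OF convex_real_interval(1), of \<delta> F] by metis
  then show ?thesis
    using \<open>\<delta> \<le> x\<close> by simp
qed

text \<open>\<open>F\<close> is constant from \<open>\<delta>\<close> on and dominated by a decaying
  exponential, so the constant is 0.\<close>

lemma vanishing_at_top:
  fixes F :: "real \<Rightarrow> 'a::real_normed_vector"
  assumes "\<mu> < 0" and F: "\<And>x. \<delta> \<le> x \<Longrightarrow> (F has_vector_derivative 0) (at x)"
    and B: "\<And>x. norm (F x) \<le> exp (\<mu> * x) * B" and "\<delta> \<le> x"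
  shows "F x = 0"
proof -
  define k where "k = F \<delta>"
  have k: "F x = k" if "\<delta> \<le> x" for x
    unfolding k_def by (rule has_vector_derivative_0_imp_eq[OF F that])
  have "(F \<longlongrightarrow> 0) at_top"
  proof (rule Lim_null_comparison)
    show "\<forall>\<^sub>F x in at_top. norm (F x) \<le> exp (\<mu> * x) * B"
      using B by simp
    have "filterlim (\<lambda>x. \<mu> * x) at_bot at_top"
      using \<open>\<mu> < 0\<close> by (intro filterlim_tendsto_neg_mult_at_bot[OF tendsto_const]) (auto simp: filterlim_ident)
    then show "((\<lambda>x. exp (\<mu> * x) * B) \<longlongrightarrow> 0) at_top"
      by (intro tendsto_mult_left_zero filterlim_compose[OF exp_at_bot])
  qed
  moreover have "(F \<longlongrightarrow> k) at_top"
    by (rule Lim_transform_eventually[OF tendsto_const])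
      (auto simp: eventually_at_top_linorder k intro!: exI[of _ \<delta>])
  ultimately have "k = 0"
    by (rule tendsto_unique[OF trivial_limit_at_top_linorder, symmetric])
  then show ?thesis
    using k \<open>\<delta> \<le> x\<close> by simp
qed

lemma vanishing_at_bot:
  fixes F :: "real \<Rightarrow> 'a::real_normed_vector"
  assumes "\<mu> > 0" and F: "\<And>x. x \<le> - \<delta> \<Longrightarrow> (F has_vector_derivative 0) (at x)"
    and B: "\<And>x. norm (F x) \<le> exp (\<mu> * x) * B" and "x \<le> - \<delta>"
  shows "F x = 0"
proof -
  have "F (- (- x)) = 0"
  proof (rule vanishing_at_top[where F = "\<lambda>x. F (- x)" and \<mu> = "- \<mu>" and \<delta> = \<delta> and B = B])
    show "((\<lambda>x. F (- x)) has_vector_derivative 0) (at x)" if "\<delta> \<le> x" for x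
    proof -
      have "((F \<circ> uminus) has_vector_derivative - 1 *\<^sub>R 0) (at x)"
        by (rule vector_diff_chain_at) (use F[of "- x"] that in \<open>auto intro!: derivative_eq_intros\<close>)
      then show ?thesis by (simp add: o_def)
    qed
    show "norm (F (- x)) \<le> exp (- \<mu> * x) * B" for x
      using B[of "- x"] by simp
  qed (use assms in auto)
  then show ?thesis by simp
qed

text \<open>If \<open>z\<close> is a root of the characteristic polynomial, then \<open>e\<^sup>-\<^sup>z\<^sup>x L u\<close> is the derivative of
  \<open>e\<^sup>-\<^sup>z\<^sup>x\<close> times the following first integral.\<close>
definition first_integral ::
  "real \<Rightarrow> real \<Rightarrow> complex \<Rightarrow> (real \<Rightarrow> real) \<Rightarrow> (real \<Rightarrow> real) \<Rightarrow> (real \<Rightarrow> real) \<Rightarrow> real \<Rightarrow> complex"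
where
  "first_integral c D z u u1 u2 x = c * u2 x + (c * z + D) * u1 x + (c * z\<^sup>2 + D * z - c) * u x"

text \<open>Dividing the characteristic polynomial by \<open>X - z\<close> leaves the quotient
  \<open>c X^2 + (c z + D) X + (c z^2 + D z - c)\<close> and no remainder. Hence \<open>L u\<close>
  is \<open>I' - z I\<close> for the first integral \<open>I\<close>, and the exponential is the
  integrating factor.\<close>

lemma first_integral_derivative:
  fixes z :: complex
  assumes u: "\<And>x. (u has_real_derivative u1 x) (at x)" "\<And>x. (u1 has_real_derivative u2 x) (at x)"
    "\<And>x. (u2 has_real_derivative u3 x) (at x)"
    and z: "c * z ^ 3 + D * z\<^sup>2 - c * z - \<beta> = 0"
  shows "((\<lambda>x. exp (x *\<^sub>R (- z)) * first_integral c D z u u1 u2 x) has_vector_derivative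
    exp (x *\<^sub>R (- z)) * of_real (c * u3 x + D * u2 x - c * u1 x - \<beta> * u x)) (at x)"
proof -
  have \<beta>: "of_real \<beta> = c * z ^ 3 + D * z\<^sup>2 - c * z"
    using z by (simp add: algebra_simps)
  have "(first_integral c D z u u1 u2 has_vector_derivative
      of_real c * of_real (u3 x) + (c * z + D) * of_real (u2 x) + (c * z\<^sup>2 + D * z - c) * of_real (u1 x)) (at x)"
    unfolding first_integral_def[abs_def]
    by (intro has_vector_derivative_add has_vector_derivative_mult_right has_vector_derivative_of_real u)
  note * = has_vector_derivative_mult[OF exp_scaleR_has_vector_derivative_right[of "- z"] this]
  show ?thesis
    by (rule has_vector_derivative_eq_rhs[OF *])
      (simp add: \<beta> first_integral_def algebra_simps power3_eq_cube power2_eq_square)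
qed

lemma first_integral_bounded:
  assumes "bounded (range u)" "bounded (range u1)" "bounded (range u2)"
  obtains B where "\<And>x. norm (first_integral c D z u u1 u2 x) \<le> B"
proof -
  from assms obtain B0 B1 B2 where B: "\<And>x. \<bar>u x\<bar> \<le> B0" "\<And>x. \<bar>u1 x\<bar> \<le> B1" "\<And>x. \<bar>u2 x\<bar> \<le> B2"
    by (auto simp: bounded_iff)
  have "norm (first_integral c D z u u1 u2 x)
      \<le> \<bar>c\<bar> * B2 + norm (c * z + D) * B1 + norm (c * z\<^sup>2 + D * z - c) * B0" for x
    unfolding first_integral_def
    by (intro order_trans[OF norm_triangle_ineq] add_mono)
      (auto simp: norm_mult intro!: mult_left_mono B)
  then show thesis by (rule that)
qed

text \<open>For \<open>x \<ge> \<delta>\<close> the first integral of the positive root vanishes while that of the complex root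
  is \<open>\<kappa> e\<^sup>z\<^sup>x\<close> with \<open>\<kappa> \<noteq> 0\<close>, so their difference forces \<open>u\<close> to oscillate around \<open>0\<close>.\<close>
lemma Green_function_no_complex_roots:
  fixes z :: complex
  assumes G: "is_Green_function c D \<beta> G" "\<And>x. G x \<le> 0" and "c > 0"
    and r: "r > 0" "c * r ^ 3 + D * r\<^sup>2 - c * r - \<beta> = 0"
    and z: "c * z ^ 3 + D * z\<^sup>2 - c * z - \<beta> = 0" "Re z < 0" "Im z > 0"
    and Vieta: "c * (r + 2 * Re z) = - D"
  shows False
proof -
  define a b where "a = Re z" and "b = Im z"
  have ab: "a < 0" "b > 0" "z = Complex a b"
    using z by (auto simp: a_def b_def complex_eq_iff)
  \<comment> \<open>The bump is narrow enough that \<open>b * x\<close> stays within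
    \<open>pi / 4\<close> of 0 on its support, where the cosine is positive.\<close>
  define \<delta> where "\<delta> = pi / (4 * b)"
  have "\<delta> > 0"
    using ab by (simp add: \<delta>_def)
  obtain \<rho> u u1 u2 u3 where \<rho>: "\<And>x. 0 \<le> \<rho> x" "0 < \<rho> 0" "\<And>x. \<delta> \<le> \<bar>x\<bar> \<Longrightarrow> \<rho> x = 0"
    and u: "\<And>x. (u has_real_derivative u1 x) (at x)" "\<And>x. (u1 has_real_derivative u2 x) (at x)"
      "\<And>x. (u2 has_real_derivative u3 x) (at x)"
    and bu: "bounded (range u)" "bounded (range u1)" "bounded (range u2)"
    and u_le: "\<And>x. u x \<le> 0" and Lu: "\<And>x. c * u3 x + D * u2 x - c * u1 x - \<beta> * u x = \<rho> x"
    using Green_function_mollified[OF G \<open>\<delta> > 0\<close>] by metis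
  define I where "I y = first_integral c D y u u1 u2" for y
  define F where "F y x = exp (x *\<^sub>R (- y)) * I y x" for y x
  have r': "complex_of_real c * complex_of_real r ^ 3 + complex_of_real D * (complex_of_real r)\<^sup>2
      - complex_of_real c * complex_of_real r - complex_of_real \<beta> = 0"
    using arg_cong[OF r(2), of complex_of_real] by simp
  have dF: "(F y has_vector_derivative exp (x *\<^sub>R (- y)) * of_real (\<rho> x)) (at x)"
    if "y = z \<or> y = of_real r" for y x
    using that first_integral_derivative[OF u z(1), of x] first_integral_derivative[OF u r', of x]
    unfolding F_def[abs_def] I_def Lu by auto
  have dF0: "(F y has_vector_derivative 0) (at x)" if "y = z \<or> y = of_real r" "\<delta> \<le> \<bar>x\<bar>" for y x
    using dF[OF that(1), of x] \<rho>(3)[OF that(2)] by simp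
  have bF: "\<exists>B. \<forall>x. norm (F y x) \<le> exp (- Re y * x) * B" for y
  proof -
    obtain B where "\<And>x. norm (I y x) \<le> B"
      unfolding I_def using first_integral_bounded[OF bu, of c D y] by blast
    then have "norm (F y x) \<le> exp (- Re y * x) * B" for x
      by (auto simp: F_def norm_mult norm_exp_eq_Re mult.commute intro!: mult_left_mono)
    then show ?thesis by blast
  qed
  \<comment> \<open>Outside the support of \<open>\<rho>\<close> each \<open>F y\<close> is locally
    constant. The factor \<open>exp (- r * x)\<close> decays at the right end and
    \<open>exp (- a * x)\<close> at the left end, which decides where \<open>F r\<close> and
    \<open>F z\<close> vanish.\<close>
  have Fr: "F (of_real r) x = 0" if "\<delta> \<le> x" for x
  proof -
    obtain B where "\<And>x. norm (F (of_real r) x) \<le> exp (- r * x) * B"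
      using bF[of "of_real r"] by auto
    then show ?thesis
      using vanishing_at_top[of "- r" \<delta> "F (of_real r)" B x] r(1) dF0[of "of_real r"] that \<open>\<delta> > 0\<close> by auto
  qed
  have F_bot: "F z (- \<delta>) = 0"
  proof -
    obtain B where "\<And>x. norm (F z x) \<le> exp (- a * x) * B"
      using bF[of z] by (auto simp: a_def)
    then show ?thesis
      using vanishing_at_bot[of "- a" \<delta> "F z" B "- \<delta>"] ab dF0[of z] \<open>\<delta> > 0\<close> by auto
  qed
  define \<kappa> where "\<kappa> = F z \<delta>"
  have F_top: "F z x = \<kappa>" if "\<delta> \<le> x" for x
  proof -
    show ?thesis
      unfolding \<kappa>_def by (rule has_vector_derivative_0_imp_eq[OF dF0 that]) auto
  qed
  have "\<kappa> \<noteq> 0"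
  proof -
    \<comment> \<open>\<open>R\<close> starts from 0 at \<open>- \<delta>\<close> and has a
      derivative that is nonnegative up to \<open>\<delta>\<close> and positive at 0; so the real
      part of \<open>\<kappa>\<close> is positive.\<close>
    define R R' where "R x = Re (F z x)" and "R' x = exp (- a * x) * cos (b * x) * \<rho> x" for x
    have dR: "(R has_real_derivative R' x) (at x)" for x
      using bounded_linear.has_vector_derivative[OF bounded_linear_Re dF[of z x]] ab
      by (simp add: R_def[abs_def] R'_def has_real_derivative_iff_has_vector_derivative
          Re_exp mult.commute mult.left_commute)
    have R'_nonneg: "0 \<le> R' x" if "- \<delta> \<le> x" "x \<le> \<delta>" for x
    proof -
      have "b * x \<le> b * \<delta>" "b * (- \<delta>) \<le> b * x"
        using mult_left_mono[OF that(1), of b] mult_left_mono[OF that(2), of b] ab by auto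
      moreover have "b * \<delta> = pi / 4"
        using ab by (simp add: \<delta>_def)
      ultimately have "- (pi / 2) \<le> b * x" "b * x \<le> pi / 2"
        using pi_gt_zero by auto
      then show ?thesis
        using \<rho>(1) by (simp add: R'_def cos_ge_zero)
    qed
    have mono: "R x \<le> R y" if "- \<delta> \<le> x" "x \<le> y" "y \<le> \<delta>" for x y
    proof (rule DERIV_nonneg_imp_nondecreasing[OF that(2)], intro exI conjI)
      show "(R has_real_derivative R' t) (at t)" for t by (rule dR)
      show "0 \<le> R' t" if "x \<le> t" "t \<le> y" for t
        using that \<open>- \<delta> \<le> x\<close> \<open>y \<le> \<delta>\<close> by (intro R'_nonneg) auto
    qed
    have "R' 0 > 0"
      using \<rho>(2) by (simp add: R'_def)
    then obtain d where d: "d > 0" "\<And>h. 0 < h \<Longrightarrow> h < d \<Longrightarrow> R 0 < R (0 + h)"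
      using DERIV_pos_inc_right[OF dR, of 0] by blast
    \<comment> \<open>The minimum keeps the point of strict increase inside the interval on which
      \<open>R\<close> is known to be nondecreasing.\<close>
    have "R 0 < R (min \<delta> (d / 2))"
      using d(1) d(2)[of "min \<delta> (d / 2)"] \<open>\<delta> > 0\<close> by simp
    moreover have "R (min \<delta> (d / 2)) \<le> R \<delta>" "R (- \<delta>) \<le> R 0"
      using d(1) \<open>\<delta> > 0\<close> by (auto intro!: mono)
    moreover have "R (- \<delta>) = 0" "R \<delta> = Re \<kappa>"
      by (simp_all add: R_def F_bot \<kappa>_def)
    ultimately show ?thesis
      by force
  qed
  have nz: "of_real c * (z - of_real r) \<noteq> 0"
    using \<open>c > 0\<close> r(1) ab by (auto simp: complex_eq_iff)
  define \<kappa>' where "\<kappa>' = \<kappa> / (c * (z - r))"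
  have "Re \<kappa>' * sin (b * x) + Im \<kappa>' * cos (b * x) \<le> 0" if "\<delta> \<le> x" for x
  proof -
    have "I (of_real r) x = 0"
      using Fr[OF that] by (simp add: F_def)
    then have "I z x = I z x - I (of_real r) x" by simp
    \<comment> \<open>Subtracting the two first integrals eliminates \<open>u2\<close>. By
      \<open>Vieta\<close> the remaining coefficient \<open>z + r + D / c\<close> equals
      \<open>z - 2 * a\<close>, that is, minus the conjugate of \<open>z\<close>.\<close>
    also have "\<dots> = c * (z - r) * (u1 x + (z - 2 * a) * u x)"
    proof -
      have "complex_of_real D = - of_real c * (of_real r + 2 * of_real a)"
        using arg_cong[OF Vieta, of complex_of_real] by (simp add: a_def)
      then have 1: "of_real c * (z + of_real r) + of_real D = of_real c * (z - 2 * of_real a)"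
        by (simp only:) (simp add: algebra_simps)
      have "I z x - I (of_real r) x
          = (z - of_real r) * (of_real c * of_real (u1 x) + (of_real c * (z + of_real r) + of_real D) * of_real (u x))"
        by (simp add: I_def first_integral_def algebra_simps power2_eq_square)
      then show ?thesis
        unfolding 1 by (simp add: algebra_simps)
    qed
    finally have "I z x / (c * (z - r)) = u1 x + (z - 2 * a) * u x"
      using nz by (simp add: field_simps)
    moreover have "I z x = exp (x *\<^sub>R z) * \<kappa>"
      using F_top[OF that] by (auto simp: F_def mult.assoc[symmetric] simp flip: exp_add)
    ultimately have "exp (x *\<^sub>R z) * \<kappa>' = u1 x + (z - 2 * a) * u x"
      by (simp add: \<kappa>'_def)
    \<comment> \<open>\<open>u1\<close> and \<open>u\<close> are real, so the imaginary part removes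
      \<open>u1\<close> and leaves \<open>b * u x\<close>, whose sign is known.\<close>
    from arg_cong[OF this, of Im]
    have "exp (a * x) * (Re \<kappa>' * sin (b * x) + Im \<kappa>' * cos (b * x)) = b * u x"
      by (simp add: ab(3) Re_exp Im_exp algebra_simps)
    also have "\<dots> \<le> 0"
      using ab(2) u_le by (simp add: mult_le_0_iff)
    finally show ?thesis
      by (simp add: mult_le_0_iff)
  qed
  from sinusoid_nonpos_imp_0[OF ab(2) this] have "\<kappa>' = 0"
    by (simp add: complex_eq_iff)
  then show False
    using \<open>\<kappa> \<noteq> 0\<close> nz by (simp add: \<kappa>'_def)
qed

section \<open>Bounded solutions of the linear equation\<close>

text \<open>The integrating factor makes \<open>exp (- \<mu> * x) * v x\<close> nondecreasing, and
  boundedness of \<open>v\<close> makes it tend to 0 at the left end.\<close>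

lemma bounded_solution_nonneg:
  fixes v g :: "real \<Rightarrow> real"
  assumes "\<mu> < 0" and v: "\<And>x. (v has_real_derivative \<mu> * v x + g x) (at x)"
    and b: "bounded (range v)" and g: "\<And>x. 0 \<le> g x"
  shows "0 \<le> v x"
proof -
  obtain B where B: "\<And>x. \<bar>v x\<bar> \<le> B"
    using b by (auto simp: bounded_iff)
  have mono: "exp (-\<mu> * y) * v y \<le> exp (-\<mu> * x) * v x" if "y \<le> x" for y
  proof (rule DERIV_nonneg_imp_nondecreasing[OF that], intro exI conjI)
    show "((\<lambda>x. exp (-\<mu> * x) * v x) has_real_derivative exp (-\<mu> * z) * g z) (at z)" for z
      by (auto intro!: derivative_eq_intros v simp: algebra_simps)
  qed (use g in simp)
  have "((\<lambda>y. exp (-\<mu> * y) * v y) \<longlongrightarrow> 0) at_bot"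
  proof (rule Lim_null_comparison)
    show "\<forall>\<^sub>F y in at_bot. norm (exp (-\<mu> * y) * v y) \<le> exp (-\<mu> * y) * B"
      using B by (simp add: abs_mult)
    have "filterlim (\<lambda>y. -\<mu> * y) at_bot at_bot"
      using \<open>\<mu> < 0\<close> by (intro filterlim_tendsto_pos_mult_at_bot[OF tendsto_const]) (auto simp: filterlim_ident)
    then show "((\<lambda>y. exp (-\<mu> * y) * B) \<longlongrightarrow> 0) at_bot"
      by (intro tendsto_mult_left_zero filterlim_compose[OF exp_at_bot])
  qed
  then have "0 \<le> exp (-\<mu> * x) * v x"
    by (rule tendsto_upperbound) (use mono in \<open>auto simp: eventually_at_bot_linorder intro!: exI[of _ x]\<close>)
  then show ?thesis
    by (simp add: zero_le_mult_iff)
qed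

text \<open>Replacing \<open>v x\<close> by \<open>- v (- x)\<close> changes \<open>\<mu>\<close>
  into \<open>- \<mu>\<close> and keeps the sign of the forcing.\<close>

lemma bounded_solution_nonpos:
  fixes v g :: "real \<Rightarrow> real"
  assumes "\<mu> > 0" and v: "\<And>x. (v has_real_derivative \<mu> * v x + g x) (at x)"
    and b: "bounded (range v)" and g: "\<And>x. 0 \<le> g x"
  shows "v x \<le> 0"
proof -
  have "0 \<le> - v (- (- x))"
  proof (rule bounded_solution_nonneg[where \<mu> = "-\<mu>" and v = "\<lambda>x. - v (- x)" and g = "\<lambda>x. g (- x)"])
    show "((\<lambda>x. - v (- x)) has_real_derivative - \<mu> * - v (- x) + g (- x)) (at x)" for x
      by (rule derivative_eq_intros DERIV_chain2[OF v] refl)+ simp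
    show "bounded (range (\<lambda>x. - v (- x)))"
      using b by (auto simp: bounded_iff)
  qed (use assms in auto)
  then show ?thesis by simp
qed

text \<open>Variation of constants from the left end. The improper integral is avoided:
  \<open>E\<close> is an antiderivative of the majorant \<open>M * exp (- \<mu> * x)\<close>, and
  \<open>F\<close> is compared with it.\<close>

lemma first_order_bounded_solution_neg:
  fixes h :: "real \<Rightarrow> real"
  assumes "\<mu> < 0" and h: "continuous_on UNIV h" and b: "bounded (range h)"
  obtains v where "\<And>x. (v has_real_derivative \<mu> * v x + h x) (at x)" "bounded (range v)"
proof -
  obtain M where M: "\<And>x. \<bar>h x\<bar> \<le> M"
    using b by (auto simp: bounded_iff)
  have "continuous_on UNIV (\<lambda>s. exp (-\<mu> * s) * h s)"
    by (intro continuous_intros h)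
  then obtain F where "\<And>x. (F has_vector_derivative exp (-\<mu> * x) * h x) (at x)"
    using einterval_antiderivative[of "-\<infinity>" "\<infinity>" "\<lambda>s. exp (-\<mu> * s) * h s"]
    by (auto simp: continuous_on_eq_continuous_at)
  then have F: "(F has_real_derivative exp (-\<mu> * x) * h x) (at x)" for x
    by (simp add: has_real_derivative_iff_has_vector_derivative)
  define E where "E s = M * exp (-\<mu> * s) / (-\<mu>)" for s
  have E: "(E has_real_derivative M * exp (-\<mu> * x)) (at x)" for x
    unfolding E_def using \<open>\<mu> < 0\<close> by (auto intro!: derivative_eq_intros)
  have "0 \<le> M"
    using M[of 0] by simp
  then have E0: "0 \<le> E s" for s
    using \<open>\<mu> < 0\<close> unfolding E_def by (intro divide_nonneg_pos) auto
  have inc: "F s + E s \<le> F t + E t" if "s \<le> t" for s t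
  proof (rule DERIV_nonneg_imp_nondecreasing[OF that], intro exI conjI)
    show "((\<lambda>x. F x + E x) has_real_derivative exp (-\<mu> * z) * (M + h z)) (at z)" for z
      by (auto intro!: derivative_eq_intros F E simp: algebra_simps)
    show "0 \<le> exp (-\<mu> * z) * (M + h z)" for z
      using M[of z] by simp
  qed
  have dec: "F t - E t \<le> F s - E s" if "s \<le> t" for s t
  proof (rule DERIV_nonpos_imp_nonincreasing[OF that], intro exI conjI)
    show "((\<lambda>x. F x - E x) has_real_derivative exp (-\<mu> * z) * (h z - M)) (at z)" for z
      by (auto intro!: derivative_eq_intros F E simp: algebra_simps)
    show "exp (-\<mu> * z) * (h z - M) \<le> 0" for z
      using M[of z] by (simp add: mult_le_0_iff)
  qed
  \<comment> \<open>\<open>l\<close> stands for the limit of \<open>F\<close> at the left end, where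
    \<open>E\<close> tends to 0. Being trapped between \<open>F - E\<close> and
    \<open>F + E\<close>, it satisfies \<open>\<bar>F t - l\<bar> \<le> E t\<close>.\<close>
  define l where "l = Inf (range (\<lambda>s. F s + E s))"
  have lb: "F t - E t \<le> F s + E s" for s t
    using inc[of t s] dec[of s t] E0[of s] E0[of t] by (cases "s \<le> t") auto
  then have l1: "F t - E t \<le> l" for t
    unfolding l_def by (intro cInf_greatest) auto
  have l2: "l \<le> F t + E t" for t
    unfolding l_def by (rule cInf_lower) (auto intro!: bdd_belowI[of _ "F 0 - E 0"] lb)
  define v where "v t = exp (\<mu> * t) * (F t - l)" for t
  show thesis
  proof
    show "(v has_real_derivative \<mu> * v x + h x) (at x)" for x
      unfolding v_def
      by (rule derivative_eq_intros F refl)+ (simp add: algebra_simps flip: exp_add)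
    have "\<bar>v t\<bar> \<le> M / (-\<mu>)" for t
    proof -
      have "\<bar>v t\<bar> = exp (\<mu> * t) * \<bar>F t - l\<bar>"
        by (simp add: v_def abs_mult)
      also have "\<dots> \<le> exp (\<mu> * t) * E t"
        using l1[of t] l2[of t] by (intro mult_left_mono) auto
      also have "\<dots> = M / (-\<mu>)"
        by (simp add: E_def flip: exp_add)
      finally show ?thesis .
    qed
    then show "bounded (range v)"
      by (auto simp: bounded_iff)
  qed
qed

lemma first_order_bounded_solution:
  fixes h :: "real \<Rightarrow> real"
  assumes "\<mu> \<noteq> 0" and h: "continuous_on UNIV h" and b: "bounded (range h)"
  obtains v where "\<And>x. (v has_real_derivative \<mu> * v x + h x) (at x)" "bounded (range v)"
proof (cases "\<mu> < 0")
  case True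
  then show thesis
    using first_order_bounded_solution_neg[OF _ h b] that by blast
next
  case False
  have "continuous_on UNIV (\<lambda>x. h (- x))"
    by (rule continuous_on_compose2[OF h]) (auto intro: continuous_intros)
  moreover have "bounded (range (\<lambda>x. h (- x)))"
    using b by (auto simp: bounded_iff)
  ultimately obtain v where
    v: "\<And>x. (v has_real_derivative - \<mu> * v x + h (- x)) (at x)" and bv: "bounded (range v)"
    using first_order_bounded_solution_neg[of "-\<mu>" "\<lambda>x. h (- x)"] False \<open>\<mu> \<noteq> 0\<close> by force
  show thesis
  proof
    show "((\<lambda>x. - v (- x)) has_real_derivative \<mu> * - v (- x) + h x) (at x)" for x
      by (rule derivative_eq_intros DERIV_chain2[OF v] refl)+ simp
    show "bounded (range (\<lambda>x. - v (- x)))"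
      using bv by (auto simp: bounded_iff)
  qed
qed

text \<open>The constants \<open>- M / \<mu>\<close> and \<open>M / \<mu>\<close> solve the equation
  with forcing \<open>M\<close> and \<open>- M\<close>. The sign lemmas, applied to their
  differences with \<open>v\<close>, trap \<open>v\<close> between them.\<close>

lemma first_order_abs_bound:
  fixes v g :: "real \<Rightarrow> real"
  assumes "\<mu> \<noteq> 0" and v: "\<And>x. (v has_real_derivative \<mu> * v x + g x) (at x)"
    and b: "bounded (range v)" and g: "\<And>x. \<bar>g x\<bar> \<le> M"
  shows "\<bar>v x\<bar> \<le> M / \<bar>\<mu>\<bar>"
proof -
  have d1: "((\<lambda>x. M / \<mu> + v x) has_real_derivative \<mu> * (M / \<mu> + v x) + (g x - M)) (at x)"
    and d2: "((\<lambda>x. M / \<mu> - v x) has_real_derivative \<mu> * (M / \<mu> - v x) + (- g x - M)) (at x)"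
    and d3: "((\<lambda>x. - M / \<mu> - v x) has_real_derivative \<mu> * (- M / \<mu> - v x) + (M - g x)) (at x)"
    and d4: "((\<lambda>x. - M / \<mu> + v x) has_real_derivative \<mu> * (- M / \<mu> + v x) + (M + g x)) (at x)"
    for x
    using \<open>\<mu> \<noteq> 0\<close> by (auto intro!: derivative_eq_intros v simp: algebra_simps)
  obtain B where B: "\<And>x. \<bar>v x\<bar> \<le> B"
    using b by (auto simp: bounded_iff)
  have bd: "bounded (range (\<lambda>x. k + v x))" "bounded (range (\<lambda>x. k - v x))" for k
    unfolding bounded_iff
    by (rule exI[of _ "\<bar>k\<bar> + B"], use B in \<open>force intro: order_trans[OF abs_triangle_ineq] order_trans[OF abs_triangle_ineq4] add_left_mono\<close>)+
  have gM: "0 \<le> M - g x" "0 \<le> M + g x" for x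
    using g[of x] by auto
  show ?thesis
  proof (cases "\<mu> < 0")
    case True
    show ?thesis
      using bounded_solution_nonneg[OF True d3 bd(2) gM(1), of x]
        bounded_solution_nonneg[OF True d4 bd(1) gM(2), of x] True
      by auto
  next
    case False
    then have "\<mu> > 0"
      using \<open>\<mu> \<noteq> 0\<close> by simp
    show ?thesis
      using bounded_solution_nonpos[OF \<open>\<mu> > 0\<close> d3 bd(2) gM(1), of x]
        bounded_solution_nonpos[OF \<open>\<mu> > 0\<close> d4 bd(1) gM(2), of x] \<open>\<mu> > 0\<close>
      by auto
  qed
qed

text \<open>This plays the role of \<open>u = (-G) * h\<close> (convolution).\<close>
definition Lsol :: "real \<Rightarrow> real \<Rightarrow> real \<Rightarrow> (real \<Rightarrow> real) \<Rightarrow> (real \<Rightarrow> real) \<Rightarrow> bool" where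
  "Lsol c D \<beta> h u \<longleftrightarrow> (\<exists>u1 u2 u3.
     (\<forall>x. (u has_real_derivative u1 x) (at x)) \<and> (\<forall>x. (u1 has_real_derivative u2 x) (at x)) \<and>
     (\<forall>x. (u2 has_real_derivative u3 x) (at x)) \<and>
     bounded (range u) \<and> bounded (range u1) \<and> bounded (range u2) \<and>
     (\<forall>x. c * u3 x + D * u2 x - c * u1 x - \<beta> * u x = - h x))"

lemma LsolI:
  assumes "\<And>x. (u has_real_derivative u1 x) (at x)" "\<And>x. (u1 has_real_derivative u2 x) (at x)"
    "\<And>x. (u2 has_real_derivative u3 x) (at x)"
    "bounded (range u)" "bounded (range u1)" "bounded (range u2)"
    "\<And>x. c * u3 x + D * u2 x - c * u1 x - \<beta> * u x = - h x"
  shows "Lsol c D \<beta> h u"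
  unfolding Lsol_def using assms by blast

lemma LsolE:
  assumes "Lsol c D \<beta> h u"
  obtains u1 u2 u3 where
    "\<And>x. (u has_real_derivative u1 x) (at x)" "\<And>x. (u1 has_real_derivative u2 x) (at x)"
    "\<And>x. (u2 has_real_derivative u3 x) (at x)"
    "bounded (range u)" "bounded (range u1)" "bounded (range u2)"
    "\<And>x. c * u3 x + D * u2 x - c * u1 x - \<beta> * u x = - h x"
  using assms unfolding Lsol_def by blast

lemma Lsol_diff:
  assumes "Lsol c D \<beta> h u" "Lsol c D \<beta> g v"
  shows "Lsol c D \<beta> (\<lambda>x. h x - g x) (\<lambda>x. u x - v x)"
proof -
  from assms(1) obtain u1 u2 u3 where u: "\<And>x. (u has_real_derivative u1 x) (at x)"
    "\<And>x. (u1 has_real_derivative u2 x) (at x)" "\<And>x. (u2 has_real_derivative u3 x) (at x)"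
    "bounded (range u)" "bounded (range u1)" "bounded (range u2)"
    "\<And>x. c * u3 x + D * u2 x - c * u1 x - \<beta> * u x = - h x"
    by (rule LsolE) blast
  from assms(2) obtain v1 v2 v3 where v: "\<And>x. (v has_real_derivative v1 x) (at x)"
    "\<And>x. (v1 has_real_derivative v2 x) (at x)" "\<And>x. (v2 has_real_derivative v3 x) (at x)"
    "bounded (range v)" "bounded (range v1)" "bounded (range v2)"
    "\<And>x. c * v3 x + D * v2 x - c * v1 x - \<beta> * v x = - g x"
    by (rule LsolE) blast
  show ?thesis
  proof (rule LsolI)
    show "c * (u3 x - v3 x) + D * (u2 x - v2 x) - c * (u1 x - v1 x) - \<beta> * (u x - v x)
        = - (h x - g x)" for x
      using u(7)[of x] v(7)[of x] by (simp add: algebra_simps)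
  qed (intro DERIV_diff bounded_minus_comp u v)+
qed

lemma Lsol_shift:
  assumes "Lsol c D \<beta> h u"
  shows "Lsol c D \<beta> (\<lambda>x. h (x + s)) (\<lambda>x. u (x + s))"
proof -
  from assms obtain u1 u2 u3 where u: "\<And>x. (u has_real_derivative u1 x) (at x)"
    "\<And>x. (u1 has_real_derivative u2 x) (at x)" "\<And>x. (u2 has_real_derivative u3 x) (at x)"
    "bounded (range u)" "bounded (range u1)" "bounded (range u2)"
    "\<And>x. c * u3 x + D * u2 x - c * u1 x - \<beta> * u x = - h x"
    by (rule LsolE) blast
  show ?thesis
    by (rule LsolI[where ?u1.0 = "\<lambda>x. u1 (x + s)" and ?u2.0 = "\<lambda>x. u2 (x + s)"
          and ?u3.0 = "\<lambda>x. u3 (x + s)"])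
      (use u in \<open>auto simp: DERIV_shift[symmetric] intro: bounded_subset\<close>)
qed

lemma Lsol_const: "Lsol c D \<beta> (\<lambda>_. \<beta> * k) (\<lambda>_. k)"
  by (rule LsolI[where ?u1.0 = "\<lambda>_. 0" and ?u2.0 = "\<lambda>_. 0" and ?u3.0 = "\<lambda>_. 0"]) auto

section \<open>The third-order operator with three real characteristic roots\<close>

text \<open>The three equations are Vieta's relations for \<open>c z^3 + D z^2 - c z - \<beta> = c
  (z - \<mu>1) (z - \<mu>2) (z - \<mu>3)\<close>.\<close>

locale real_roots =
  fixes c D \<beta> \<mu>1 \<mu>2 \<mu>3 :: real
  assumes c: "c > 0" and \<mu>1: "\<mu>1 > 0" and \<mu>2: "\<mu>2 < 0" and \<mu>3: "\<mu>3 < 0"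
    and D: "D = c * (- \<mu>1 - \<mu>2 - \<mu>3)" and c_eq: "- c = c * (\<mu>1 * \<mu>2 + \<mu>1 * \<mu>3 + \<mu>2 * \<mu>3)"
    and \<beta>: "\<beta> = c * \<mu>1 * \<mu>2 * \<mu>3"
begin

text \<open>With \<open>d\<close> for differentiation,
  \<open>L = c (d - \<mu>1) (d - \<mu>2) (d - \<mu>3)\<close>; the intermediate functions are
  \<open>y = (d - \<mu>3) u\<close> and \<open>w = (d - \<mu>2) y\<close>.\<close>

lemma Lsol_factorE:
  assumes "Lsol c D \<beta> h u"
  obtains y w where "\<And>x. (u has_real_derivative \<mu>3 * u x + y x) (at x)"
    "\<And>x. (y has_real_derivative \<mu>2 * y x + w x) (at x)"
    "\<And>x. (w has_real_derivative \<mu>1 * w x + - h x / c) (at x)"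
    "bounded (range u)" "bounded (range y)" "bounded (range w)"
proof -
  from assms obtain u1 u2 u3 where u: "\<And>x. (u has_real_derivative u1 x) (at x)"
    "\<And>x. (u1 has_real_derivative u2 x) (at x)" "\<And>x. (u2 has_real_derivative u3 x) (at x)"
    "bounded (range u)" "bounded (range u1)" "bounded (range u2)"
    "\<And>x. c * u3 x + D * u2 x - c * u1 x - \<beta> * u x = - h x"
    by (rule LsolE) blast
  define y where "y x = u1 x - \<mu>3 * u x" for x
  define w where "w x = (u2 x - \<mu>3 * u1 x) - \<mu>2 * y x" for x
  have bm: "bounded (range (\<lambda>x. k * v x))" if "bounded (range v)" for k :: real and v :: "real \<Rightarrow> real"
    using bounded_scaling[OF that, of k] by (simp add: image_image)
  show thesis
  proof
    show "(u has_real_derivative \<mu>3 * u x + y x) (at x)" for x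
      using u(1)[of x] by (simp add: y_def)
    show y: "(y has_real_derivative \<mu>2 * y x + w x) (at x)" for x
      unfolding w_def y_def by (rule derivative_eq_intros u refl)+ simp
    show "(w has_real_derivative \<mu>1 * w x + - h x / c) (at x)" for x
    proof -
      have "(w has_real_derivative u3 x - \<mu>3 * u2 x - \<mu>2 * (u2 x - \<mu>3 * u1 x)) (at x)"
        unfolding w_def y_def by (rule derivative_eq_intros u refl)+ simp
      moreover have "c * (u3 x - \<mu>3 * u2 x - \<mu>2 * (u2 x - \<mu>3 * u1 x)) = c * (\<mu>1 * w x) - h x"
      proof -
        \<comment> \<open>The coefficient is written as \<open>+ (- c)\<close> because
          \<open>c_eq\<close> rewrites \<open>- c\<close>.\<close>
        have "- h x = c * u3 x + D * u2 x + (- c) * u1 x - \<beta> * u x"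
          using u(7)[of x] by simp
        also have "\<dots> = c * (u3 x - \<mu>3 * u2 x - \<mu>2 * (u2 x - \<mu>3 * u1 x)) - c * (\<mu>1 * w x)"
          unfolding c_eq D \<beta> w_def y_def by (simp add: algebra_simps)
        finally show ?thesis by simp
      qed
      then have "u3 x - \<mu>3 * u2 x - \<mu>2 * (u2 x - \<mu>3 * u1 x) = \<mu>1 * w x + - h x / c"
        using c by (simp add: field_simps)
      ultimately show ?thesis by simp
    qed
    show "bounded (range u)" by fact
    show bdy: "bounded (range y)"
      unfolding y_def by (intro bounded_minus_comp bm u)
    show "bounded (range w)"
      unfolding w_def by (intro bounded_minus_comp bm u bdy)
  qed
qed

text \<open>The positive root together with the nonpositive forcing \<open>- h / c\<close> makes
  \<open>w\<close> nonnegative, and the two negative roots hand this sign on to \<open>y\<close> and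
  \<open>u\<close>. This is the comparison principle behind the iteration.\<close>

lemma Lsol_nonneg:
  assumes "Lsol c D \<beta> h u" and h: "\<And>x. 0 \<le> h x"
  shows "0 \<le> u x"
proof -
  obtain y w where uyw: "\<And>x. (u has_real_derivative \<mu>3 * u x + y x) (at x)"
    "\<And>x. (y has_real_derivative \<mu>2 * y x + w x) (at x)"
    "\<And>x. (w has_real_derivative \<mu>1 * w x + - h x / c) (at x)"
    "bounded (range u)" "bounded (range y)" "bounded (range w)"
    using Lsol_factorE[OF assms(1)] by blast
  have w': "((\<lambda>x. - w x) has_real_derivative \<mu>1 * - w x + h x / c) (at x)" for x
    by (rule derivative_eq_intros uyw refl)+ simp
  have "0 \<le> w x" for x
    using bounded_solution_nonpos[OF \<mu>1 w', of x] uyw(6) h c by (simp add: bounded_iff)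
  then have "0 \<le> y x" for x
    using bounded_solution_nonneg[OF \<mu>2 uyw(2,5)] by blast
  then show ?thesis
    using bounded_solution_nonneg[OF \<mu>3 uyw(1,4)] by blast
qed

lemma Lsol_mono:
  assumes "Lsol c D \<beta> h u" "Lsol c D \<beta> g v" "\<And>x. h x \<le> g x"
  shows "u x \<le> v x"
  using Lsol_nonneg[OF Lsol_diff[OF assms(2,1)], of x] assms(3) by simp

text \<open>The constant \<open>k\<close> is a solution for the right-hand side
  \<open>\<beta> * k\<close>, so it serves as a barrier for both differences.\<close>

lemma Lsol_abs_diff_le:
  assumes "Lsol c D \<beta> h u" "Lsol c D \<beta> g v" "\<And>x. \<bar>h x - g x\<bar> \<le> \<beta> * k"
  shows "\<bar>u x - v x\<bar> \<le> k"
proof -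
  have *: "h x - g x \<le> \<beta> * k" "g x - h x \<le> \<beta> * k" for x
    using assms(3)[of x] by auto
  have "u x - v x \<le> k"
    by (rule Lsol_mono[OF Lsol_diff[OF assms(1,2)] Lsol_const *(1)])
  moreover have "v x - u x \<le> k"
    by (rule Lsol_mono[OF Lsol_diff[OF assms(2,1)] Lsol_const *(2)])
  ultimately show ?thesis by simp
qed

text \<open>The derivative is \<open>\<mu>3 * u + y\<close>. The first-order bounds give
  \<open>M / (c * \<mu>1 * \<bar>\<mu>2\<bar>)\<close> for each summand, since \<open>\<mu>3\<close>
  cancels in the first one; hence the factor 2.\<close>

lemma Lsol_Lipschitz:
  assumes "Lsol c D \<beta> h u" and h: "\<And>x. \<bar>h x\<bar> \<le> M"
  shows "\<bar>u x - u x'\<bar> \<le> 2 * M / (c * \<mu>1 * \<bar>\<mu>2\<bar>) * \<bar>x - x'\<bar>"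
proof -
  obtain y w where uyw: "\<And>x. (u has_real_derivative \<mu>3 * u x + y x) (at x)"
    "\<And>x. (y has_real_derivative \<mu>2 * y x + w x) (at x)"
    "\<And>x. (w has_real_derivative \<mu>1 * w x + - h x / c) (at x)"
    "bounded (range u)" "bounded (range y)" "bounded (range w)"
    using Lsol_factorE[OF assms(1)] by blast
  have "\<bar>- h x / c\<bar> \<le> M / c" for x
    using h[of x] c by (simp add: divide_right_mono)
  then have "\<bar>w x\<bar> \<le> M / c / \<bar>\<mu>1\<bar>" for x
    using first_order_abs_bound[OF _ uyw(3,6)] \<mu>1 by blast
  then have y: "\<bar>y x\<bar> \<le> M / c / \<bar>\<mu>1\<bar> / \<bar>\<mu>2\<bar>" for x
    using first_order_abs_bound[OF _ uyw(2,5)] \<mu>2 by blast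
  then have u: "\<bar>u x\<bar> \<le> M / c / \<bar>\<mu>1\<bar> / \<bar>\<mu>2\<bar> / \<bar>\<mu>3\<bar>" for x
    using first_order_abs_bound[OF _ uyw(1,4)] \<mu>3 by blast
  have "\<bar>\<mu>3 * u x + y x\<bar> \<le> 2 * M / (c * \<mu>1 * \<bar>\<mu>2\<bar>)" for x
  proof -
    have "\<bar>\<mu>3 * u x\<bar> \<le> M / c / \<bar>\<mu>1\<bar> / \<bar>\<mu>2\<bar>"
      using pos_le_divide_eq[THEN iffD1, OF _ u[of x]] \<mu>3 by (simp only: abs_mult mult.commute)
    then have "\<bar>\<mu>3 * u x + y x\<bar> \<le> M / c / \<bar>\<mu>1\<bar> / \<bar>\<mu>2\<bar> + M / c / \<bar>\<mu>1\<bar> / \<bar>\<mu>2\<bar>"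
      using y[of x] by linarith
    then show ?thesis
      using \<mu>1 by (simp add: field_simps)
  qed
  then show ?thesis
    using field_differentiable_bound[of UNIV u "\<lambda>x. \<mu>3 * u x + y x" "2 * M / (c * \<mu>1 * \<bar>\<mu>2\<bar>)" x x']
      uyw(1) by simp
qed

text \<open>The three first-order equations are solved in the order \<open>w\<close>,
  \<open>y\<close>, \<open>u\<close>, each solution being the bounded continuous forcing of the
  next.\<close>

lemma Lsol_exists:
  assumes "continuous_on UNIV h" and "bounded (range h)"
  shows "\<exists>u. Lsol c D \<beta> h u"
proof -
  have cont: "continuous_on UNIV v" if "\<And>x. (v has_real_derivative v' x) (at x)" for v v' :: "real \<Rightarrow> real"
    using that DERIV_isCont by (auto simp: continuous_on_eq_continuous_at)
  have bm: "bounded (range (\<lambda>x. k * v x))" if "bounded (range v)" for k :: real and v :: "real \<Rightarrow> real"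
    using bounded_scaling[OF that, of k] by (simp add: image_image)
  have ba: "bounded (range (\<lambda>x. f x + g x))" if "bounded (range f)" "bounded (range g)"
    for f g :: "real \<Rightarrow> real"
    using bounded_plus_comp[OF that] .
  have "continuous_on UNIV (\<lambda>x. - h x / c)"
    using c by (intro continuous_intros assms) auto
  moreover have "bounded (range (\<lambda>x. - h x / c))"
    using bm[OF assms(2), of "- 1 / c"] by simp
  ultimately obtain w where w: "\<And>x. (w has_real_derivative \<mu>1 * w x + - h x / c) (at x)"
      "bounded (range w)"
    using first_order_bounded_solution[of \<mu>1 "\<lambda>x. - h x / c"] \<mu>1 by auto
  obtain y where y: "\<And>x. (y has_real_derivative \<mu>2 * y x + w x) (at x)" "bounded (range y)"
    using first_order_bounded_solution[OF _ cont[OF w(1)] w(2)] \<mu>2 by (metis less_irrefl)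
  obtain u where u: "\<And>x. (u has_real_derivative \<mu>3 * u x + y x) (at x)" "bounded (range u)"
    using first_order_bounded_solution[OF _ cont[OF y(1)] y(2)] \<mu>3 by (metis less_irrefl)
  define u1 where "u1 x = \<mu>3 * u x + y x" for x
  define u2 where "u2 x = \<mu>3 * u1 x + (\<mu>2 * y x + w x)" for x
  define u3 where "u3 x = \<mu>3 * u2 x + (\<mu>2 * (\<mu>2 * y x + w x) + (\<mu>1 * w x + - h x / c))" for x
  have d0: "(u has_real_derivative u1 x) (at x)" for x
    using u(1) by (simp add: u1_def)
  have d1: "(u1 has_real_derivative u2 x) (at x)" for x
    unfolding u1_def u2_def
    by (rule derivative_eq_intros d0[unfolded u1_def] y(1) refl)+ simp
  have d2: "(u2 has_real_derivative u3 x) (at x)" for x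
  proof -
    have "((\<lambda>x. \<mu>3 * u1 x + (\<mu>2 * y x + w x)) has_real_derivative u3 x) (at x)"
      unfolding u3_def by (rule derivative_eq_intros d1 y(1) w(1) refl)+ simp
    then show ?thesis
      by (simp add: u2_def[abs_def])
  qed
  have "Lsol c D \<beta> h u"
  proof (rule LsolI[OF d0 d1 d2])
    show "bounded (range u)" by fact
    show b1: "bounded (range u1)"
      unfolding u1_def by (intro ba bm u y)
    show "bounded (range u2)"
      unfolding u2_def by (intro ba bm b1 y w)
    have "c * u3 x + D * u2 x + (- c) * u1 x - \<beta> * u x = - h x" for x
    proof -
      have "c * u3 x + D * u2 x + (- c) * u1 x - \<beta> * u x = c * (- h x / c)"
        unfolding c_eq D \<beta> by (simp add: u3_def u2_def u1_def algebra_simps)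
      then show ?thesis using c by simp
    qed
    then show "c * u3 x + D * u2 x - c * u1 x - \<beta> * u x = - h x" for x by simp
  qed
  then show ?thesis by blast
qed

end

text \<open>A positive root is split off. A complex pair in the quadratic cofactor would have
  negative real part, which the sign of \<open>G\<close> excludes; real roots of the cofactor have
  negative sum and positive product.\<close>

lemma Green_function_real_roots:
  assumes G: "is_Green_function c D \<beta> G" "\<And>x. G x \<le> 0" and "c > 0" "D > 0" "\<beta> > 0"
  obtains \<mu>1 \<mu>2 \<mu>3 where "real_roots c D \<beta> \<mu>1 \<mu>2 \<mu>3"
proof -
  \<comment> \<open>Since \<open>t \<ge> 1\<close>, the cubic at \<open>t\<close> is at least
    \<open>D * t - \<beta> = D\<close>, while at 0 it is \<open>- \<beta>\<close>.\<close>
  define t where "t = 1 + \<beta> / D"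
  have "t \<ge> 1"
    using assms by (simp add: t_def)
  have "\<exists>r\<ge>0. r \<le> t \<and> c * r ^ 3 + D * r\<^sup>2 - c * r - \<beta> = 0"
  proof (rule IVT')
    have "c * t \<le> c * t ^ 3"
      using \<open>t \<ge> 1\<close> \<open>c > 0\<close> power_increasing[of 1 3 t] by simp
    moreover have "D * t \<le> D * t\<^sup>2"
      using \<open>t \<ge> 1\<close> \<open>D > 0\<close> power_increasing[of 1 2 t] by simp
    moreover have "D * t = D + \<beta>"
      using \<open>D > 0\<close> by (simp add: t_def field_simps)
    ultimately show "0 \<le> c * t ^ 3 + D * t\<^sup>2 - c * t - \<beta>"
      using \<open>D > 0\<close> by linarith
  qed (use assms \<open>t \<ge> 1\<close> in \<open>auto intro!: continuous_intros\<close>)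
  then obtain r where r: "r \<ge> 0" "c * r ^ 3 + D * r\<^sup>2 - c * r - \<beta> = 0" by blast
  with \<open>\<beta> > 0\<close> have "r > 0"
    by (cases "r = 0") auto
  \<comment> \<open>The cofactor of \<open>X - r\<close> is
    \<open>c X^2 + p X + \<beta> / r\<close>.\<close>
  define p where "p = D + c * r"
  have "p > 0"
    using assms \<open>r > 0\<close> by (simp add: p_def add_pos_pos)
  have \<beta>: "\<beta> / r = c * r\<^sup>2 + D * r - c"
    using r(2) \<open>r > 0\<close> by (simp add: field_simps power2_eq_square power3_eq_cube)
  define disc where "disc = p\<^sup>2 - 4 * c * (\<beta> / r)"
  have "disc \<ge> 0"
  proof (rule ccontr)
    assume "\<not> disc \<ge> 0"
    then obtain T where T: "T > 0" "T\<^sup>2 = - disc"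
      by (intro that[of "sqrt (- disc)"]) auto
    define z where "z = Complex (- p / (2 * c)) (T / (2 * c))"
    have "of_real c * z\<^sup>2 + of_real p * z + of_real (\<beta> / r) = 0"
    proof -
      have q: "\<beta> / r = (T\<^sup>2 + p\<^sup>2) / (4 * c)"
        using T(2) \<open>c > 0\<close> by (simp add: disc_def)
      show ?thesis
        unfolding q using \<open>c > 0\<close> by (simp add: z_def complex_eq_iff power2_eq_square field_simps)
    qed
    moreover have "c * z ^ 3 + D * z\<^sup>2 - c * z - \<beta> = (z - of_real r) * (of_real c * z\<^sup>2 + of_real p * z + of_real (\<beta> / r))"
    proof -
      have "\<beta> = r * (c * r\<^sup>2 + D * r - c)"
        using r(2) by (simp add: algebra_simps power2_eq_square power3_eq_cube)
      then have eq: "complex_of_real \<beta> = of_real r * (of_real c * (of_real r)\<^sup>2 + of_real D * of_real r - of_real c)"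
        by (metis of_real_mult of_real_add of_real_diff of_real_power)
      have q: "complex_of_real (\<beta> / r) = of_real c * (of_real r)\<^sup>2 + of_real D * of_real r - of_real c"
        unfolding \<beta> by simp
      show ?thesis
        unfolding eq q p_def by (simp add: algebra_simps power2_eq_square power3_eq_cube)
    qed
    ultimately have "c * z ^ 3 + D * z\<^sup>2 - c * z - \<beta> = 0" by simp
    then show False
      by (rule Green_function_no_complex_roots[OF G \<open>c > 0\<close> \<open>r > 0\<close> r(2)])
        (use \<open>c > 0\<close> \<open>p > 0\<close> T(1) in \<open>auto simp: z_def p_def field_simps\<close>)
  qed
  define s where "s = sqrt disc"
  have s: "s\<^sup>2 = disc" "s \<ge> 0"
    using \<open>disc \<ge> 0\<close> by (auto simp: s_def)
  have "s < p"
  proof (rule power2_less_imp_less)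
    show "s\<^sup>2 < p\<^sup>2"
      using assms \<open>r > 0\<close> by (simp add: s disc_def)
  qed (use \<open>p > 0\<close> in simp)
  define \<mu>2 \<mu>3 where "\<mu>2 = (- p + s) / (2 * c)" and "\<mu>3 = (- p - s) / (2 * c)"
  have sum: "c * (\<mu>2 + \<mu>3) = - p"
    using \<open>c > 0\<close> by (simp add: \<mu>2_def \<mu>3_def field_simps)
  have "c * (\<mu>2 * \<mu>3) = (p\<^sup>2 - s\<^sup>2) / (4 * c)"
    using \<open>c > 0\<close> by (simp add: \<mu>2_def \<mu>3_def field_simps power2_eq_square)
  also have "\<dots> = \<beta> / r"
    using \<open>c > 0\<close> by (simp add: s disc_def)
  finally have prod: "c * (\<mu>2 * \<mu>3) = \<beta> / r" .
  show thesis
  proof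
    show "real_roots c D \<beta> r \<mu>2 \<mu>3"
    proof
      show "\<mu>2 < 0" "\<mu>3 < 0"
        using \<open>s < p\<close> \<open>p > 0\<close> s \<open>c > 0\<close> by (auto simp: \<mu>2_def \<mu>3_def divide_less_0_iff)
      show "D = c * (- r - \<mu>2 - \<mu>3)"
        using sum by (simp add: p_def algebra_simps)
      have "c * (r * \<mu>2 + r * \<mu>3 + \<mu>2 * \<mu>3) = r * (c * (\<mu>2 + \<mu>3)) + c * (\<mu>2 * \<mu>3)"
        by (simp add: algebra_simps)
      also have "\<dots> = - c"
        unfolding sum prod \<beta> by (simp add: p_def algebra_simps power2_eq_square)
      finally show "- c = c * (r * \<mu>2 + r * \<mu>3 + \<mu>2 * \<mu>3)" by simp
      have "c * r * \<mu>2 * \<mu>3 = r * (c * (\<mu>2 * \<mu>3))"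
        by simp
      then show "\<beta> = c * r * \<mu>2 * \<mu>3"
        using \<open>r > 0\<close> by (simp add: prod)
    qed (use assms \<open>r > 0\<close> in auto)
  qed
qed

section \<open>The monotone iteration\<close>

lemma seg_in_BC:
  assumes "continuous_on UNIV \<phi>"
  shows "seg r \<phi> \<xi> \<in> mspace (BC {-r..0})"
proof -
  have *: "continuous_on {-r..0} (\<lambda>s. \<phi> (\<xi> + s))"
    by (rule continuous_on_compose2[OF assms]) (auto intro!: continuous_intros)
  moreover have "bounded ((\<lambda>s. \<phi> (\<xi> + s)) ` {-r..0})"
    by (intro compact_imp_bounded compact_continuous_image *) auto
  moreover have "continuous_on {-r..0} (restrict (\<lambda>s. \<phi> (\<xi> + s)) {-r..0})"
    by (rule continuous_on_eq[OF *]) auto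
  ultimately show ?thesis
    by (simp add: mspace_BC seg_def)
qed

lemma rescaled_in_BC:
  assumes "continuous_on UNIV \<phi>"
  shows "restrict (\<lambda>\<theta>. \<phi> (\<xi> + c * \<theta>)) {-\<tau>..0} \<in> mspace (BC {-\<tau>..0})"
proof -
  have "continuous_on UNIV (\<lambda>\<theta>. \<phi> (\<xi> + c * \<theta>))"
    by (rule continuous_on_compose2[OF assms]) (auto intro!: continuous_intros)
  from seg_in_BC[OF this, of \<tau> 0] show ?thesis
    by (simp add: seg_def)
qed

text \<open>For \<open>c > 0\<close> the rescaled argument \<open>c * \<theta>\<close> stays in the
  domain of the segment, so the inner restriction disappears.\<close>

lemma Hop_eq:
  assumes "c > 0"
  shows "Hop f c \<tau> \<beta> \<phi> \<xi> = f (restrict (\<lambda>\<theta>. \<phi> (\<xi> + c * \<theta>)) {-\<tau>..0}) + \<beta> * \<phi> \<xi>"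
proof -
  have "c * \<theta> \<in> {-(c * \<tau>)..0}" if "\<theta> \<in> {-\<tau>..0}" for \<theta>
    using mult_left_mono[of "-\<tau>" \<theta> c] that assms by (auto simp: mult_le_0_iff)
  then have "restrict (\<lambda>\<theta>. seg (c * \<tau>) \<phi> \<xi> (c * \<theta>)) {-\<tau>..0}
      = restrict (\<lambda>\<theta>. \<phi> (\<xi> + c * \<theta>)) {-\<tau>..0}"
    by (intro restrict_ext) (simp add: seg_def)
  then show ?thesis
    by (simp add: Hop_def fc_def)
qed

lemma Hop_mono:
  assumes "cond_C2 f c \<tau> K \<beta>" "c > 0" "\<tau> > 0"
    and "continuous_on UNIV \<phi>" "continuous_on UNIV \<psi>"
    and "\<And>x. 0 \<le> \<psi> x" "\<And>x. \<psi> x \<le> \<phi> x" "\<And>x. \<phi> x \<le> K"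
  shows "Hop f c \<tau> \<beta> \<psi> \<xi> \<le> Hop f c \<tau> \<beta> \<phi> \<xi>"
proof -
  have "fc f c \<tau> (seg (c * \<tau>) \<phi> \<xi>) - fc f c \<tau> (seg (c * \<tau>) \<psi> \<xi>)
      + \<beta> * (seg (c * \<tau>) \<phi> \<xi> 0 - seg (c * \<tau>) \<psi> \<xi> 0) \<ge> 0"
    using assms(1)[unfolded cond_C2_def, THEN conjunct2, THEN conjunct2, rule_format,
        OF seg_in_BC[OF assms(4)] seg_in_BC[OF assms(5)], of \<xi> \<xi>] assms(6-8)
    by (simp add: seg_def)
  then show ?thesis
    using assms(2,3) by (simp add: Hop_def seg_def algebra_simps)
qed

text \<open>The constant, that of \<open>f\<close> plus \<open>\<beta>\<close>, does not depend on
  \<open>\<xi>\<close>; uniform convergence therefore passes through \<open>H\<close>.\<close>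

lemma Hop_Lipschitz:
  assumes C2: "cond_C2 f c \<tau> K \<beta>" and "c > 0" "\<tau> > 0"
  obtains L where "L > 0" "\<And>\<phi> \<psi> k \<xi>. continuous_on UNIV \<phi> \<Longrightarrow> continuous_on UNIV \<psi> \<Longrightarrow>
    (\<And>x. \<bar>\<phi> x - \<psi> x\<bar> \<le> k) \<Longrightarrow> \<bar>Hop f c \<tau> \<beta> \<phi> \<xi> - Hop f c \<tau> \<beta> \<psi> \<xi>\<bar> \<le> L * k"
proof -
  from C2 obtain L where L: "L > 0" "\<And>\<phi> \<psi>. \<phi> \<in> mspace (BC {-\<tau>..0}) \<Longrightarrow> \<psi> \<in> mspace (BC {-\<tau>..0}) \<Longrightarrow>
      \<bar>f \<phi> - f \<psi>\<bar> \<le> L * mdist (BC {-\<tau>..0}) \<phi> \<psi>" and "\<beta> > 0"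
    unfolding cond_C2_def by blast
  show thesis
  proof
    show "L + \<beta> > 0"
      using L(1) \<open>\<beta> > 0\<close> by simp
    fix \<phi> \<psi> :: "real \<Rightarrow> real" and k \<xi>
    assume cont: "continuous_on UNIV \<phi>" "continuous_on UNIV \<psi>" and k: "\<And>x. \<bar>\<phi> x - \<psi> x\<bar> \<le> k"
    let ?\<phi> = "restrict (\<lambda>\<theta>. \<phi> (\<xi> + c * \<theta>)) {-\<tau>..0}" and ?\<psi> = "restrict (\<lambda>\<theta>. \<psi> (\<xi> + c * \<theta>)) {-\<tau>..0}"
    have "mdist (BC {-\<tau>..0}) ?\<phi> ?\<psi> \<le> k"
      using mdist_BC_le[OF cont[THEN rescaled_in_BC], of \<tau> \<xi> c \<xi> c k] k \<open>\<tau> > 0\<close> by simp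
    then have "\<bar>f ?\<phi> - f ?\<psi>\<bar> \<le> L * k"
      by (intro order_trans[OF L(2)[OF cont[THEN rescaled_in_BC]]] mult_left_mono) (use L(1) in auto)
    moreover have "\<bar>\<beta> * \<phi> \<xi> - \<beta> * \<psi> \<xi>\<bar> \<le> \<beta> * k"
      using k[of \<xi>] \<open>\<beta> > 0\<close> by (simp add: abs_mult flip: right_diff_distrib)
    ultimately have "\<bar>(f ?\<phi> - f ?\<psi>) + (\<beta> * \<phi> \<xi> - \<beta> * \<psi> \<xi>)\<bar> \<le> L * k + \<beta> * k"
      by linarith
    then show "\<bar>Hop f c \<tau> \<beta> \<phi> \<xi> - Hop f c \<tau> \<beta> \<psi> \<xi>\<bar> \<le> (L + \<beta>) * k"
      using \<open>c > 0\<close> by (simp add: Hop_eq algebra_simps)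
  qed
qed

text \<open>Monotonicity compares \<open>\<phi>\<close> with the constants 0 and \<open>K\<close>,
  whose images are 0 and \<open>\<beta> * K\<close> by (C1).\<close>

lemma Hop_range:
  assumes "cond_C1 f \<tau> K" "cond_C2 f c \<tau> K \<beta>" "c > 0" "\<tau> > 0"
    and "continuous_on UNIV \<phi>" "\<And>x. 0 \<le> \<phi> x" "\<And>x. \<phi> x \<le> K"
  shows "0 \<le> Hop f c \<tau> \<beta> \<phi> \<xi>" "Hop f c \<tau> \<beta> \<phi> \<xi> \<le> \<beta> * K"
proof -
  have "Hop f c \<tau> \<beta> (\<lambda>_. 0) \<xi> = 0" "Hop f c \<tau> \<beta> (\<lambda>_. K) \<xi> = \<beta> * K"
    using assms(1,3) by (simp_all add: Hop_eq cond_C1_def hat_def)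
  moreover have "K > 0"
    using assms(1) by (simp add: cond_C1_def)
  ultimately show "0 \<le> Hop f c \<tau> \<beta> \<phi> \<xi>" "Hop f c \<tau> \<beta> \<phi> \<xi> \<le> \<beta> * K"
    using Hop_mono[OF assms(2-4) assms(5), of "\<lambda>_. 0" \<xi>] Hop_mono[OF assms(2-4) _ assms(5), of "\<lambda>_. K" \<xi>] assms(6,7)
    by auto
qed

lemma Hop_shift: "Hop f c \<tau> \<beta> (\<lambda>x. \<phi> (x + s)) \<xi> = Hop f c \<tau> \<beta> \<phi> (\<xi> + s)"
  by (simp add: Hop_def seg_def add_ac)

text \<open>(C3) makes \<open>H\<close> a map into \<open>BC UNIV\<close>, and membership there
  contains both claims.\<close>

lemma Hop_continuous:
  assumes "cond_C3 f c \<tau> K \<beta>" "cond_C1 f \<tau> K"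
    and "continuous_on UNIV \<phi>" "\<And>x. 0 \<le> \<phi> x" "\<And>x. \<phi> x \<le> K"
  shows "continuous_on UNIV (Hop f c \<tau> \<beta> \<phi>)" "bounded (range (Hop f c \<tau> \<beta> \<phi>))"
proof -
  have "bounded (range \<phi>)"
    unfolding bounded_iff using assms(4,5) by (intro exI[of _ K]) auto
  then have "\<phi> \<in> mspace (submetric (BC UNIV) {\<phi>. \<forall>\<xi>. 0 \<le> \<phi> \<xi> \<and> \<phi> \<xi> \<le> K})"
    using assms(3-5) by (simp add: mspace_BC)
  then have "Hop f c \<tau> \<beta> \<phi> \<in> mspace (BC UNIV)"
    using continuous_map_funspace[OF assms(1)[unfolded cond_C3_def, THEN conjunct1]]
    by (simp add: Pi_iff)
  then show "continuous_on UNIV (Hop f c \<tau> \<beta> \<phi>)" "bounded (range (Hop f c \<tau> \<beta> \<phi>))"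
    by (auto simp: mspace_BC)
qed

section \<open>Passage between the linear equation and (W)\<close>

lemma Lsol_continuous: "Lsol c D \<beta> h u \<Longrightarrow> continuous_on UNIV u"
  by (auto simp: Lsol_def continuous_on_eq_continuous_at intro: DERIV_isCont)

text \<open>This brings upper and lower solutions into the comparison principle: for them the
  right-hand side \<open>- L \<phi>\<close> lies above or below \<open>H(\<phi>)\<close>.\<close>

lemma BC_k_3_Lsol:
  assumes "BC_k 3 \<phi>"
  shows "Lsol c D \<beta> (\<lambda>\<xi>. - (c * (deriv ^^ 3) \<phi> \<xi> + D * (deriv ^^ 2) \<phi> \<xi> - c * deriv \<phi> \<xi> - \<beta> * \<phi> \<xi>)) \<phi>"
proof (rule LsolI)
  have d: "((deriv ^^ j) \<phi> has_real_derivative (deriv ^^ Suc j) \<phi> x) (at x)" if "j < 3" for j x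
    using assms that
    by (auto simp: BC_k_def C_k_def differentiable_on_def DERIV_deriv_iff_real_differentiable)
  show "(\<phi> has_real_derivative deriv \<phi> x) (at x)"
    "(deriv \<phi> has_real_derivative (deriv ^^ 2) \<phi> x) (at x)"
    "((deriv ^^ 2) \<phi> has_real_derivative (deriv ^^ 3) \<phi> x) (at x)" for x
    using d[of 0 x] d[of 1 x] d[of 2 x] by (simp_all add: numeral_2_eq_2 numeral_3_eq_3)
  have b: "bounded (range ((deriv ^^ j) \<phi>))" if "j \<le> 3" for j
    using assms that by (auto simp: BC_k_def)
  show "bounded (range \<phi>)" "bounded (range (deriv \<phi>))" "bounded (range ((deriv ^^ 2) \<phi>))"
    using b[of 0] b[of 1] b[of 2] by simp_all
qed simp

text \<open>At a fixed point the \<open>\<beta>\<close> terms cancel. Continuity of the third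
  derivative is not part of \<open>Lsol\<close>; it comes from solving the equation for
  \<open>u3\<close>.\<close>

lemma Lsol_fixed_point_W_solution:
  assumes "Lsol c D \<beta> (Hop f c \<tau> \<beta> \<phi>) \<phi>" "c > 0" and cont: "continuous_on UNIV (Hop f c \<tau> \<beta> \<phi>)"
  shows "W_solution f c D \<tau> \<phi>"
proof -
  from assms(1) obtain u1 u2 u3 where u: "\<And>x. (\<phi> has_real_derivative u1 x) (at x)"
    "\<And>x. (u1 has_real_derivative u2 x) (at x)" "\<And>x. (u2 has_real_derivative u3 x) (at x)"
    and eq: "\<And>x. c * u3 x + D * u2 x - c * u1 x - \<beta> * \<phi> x = - Hop f c \<tau> \<beta> \<phi> x"
    by (rule LsolE) blast
  have cu: "continuous_on UNIV \<phi>" "continuous_on UNIV u1" "continuous_on UNIV u2"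
    using u by (auto simp: continuous_on_eq_continuous_at intro: DERIV_isCont)
  have "u3 = (\<lambda>x. (- Hop f c \<tau> \<beta> \<phi> x - D * u2 x + c * u1 x + \<beta> * \<phi> x) / c)"
  proof
    show "u3 x = (- Hop f c \<tau> \<beta> \<phi> x - D * u2 x + c * u1 x + \<beta> * \<phi> x) / c" for x
      using eq[of x] \<open>c > 0\<close> by (simp add: field_simps)
  qed
  then have "continuous_on UNIV u3"
    using \<open>c > 0\<close> by (auto intro!: continuous_intros cont cu)
  then have "C_k (Suc (Suc (Suc 0))) \<phi>"
    by (intro C_k_SucI[OF u(1)] C_k_SucI[OF u(2)] C_k_SucI[OF u(3)]) (simp add: C_k_0)
  moreover have "deriv \<phi> = u1" "deriv u1 = u2" "deriv u2 = u3"
    by (rule ext, rule DERIV_imp_deriv, rule u)+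
  moreover have "c * u3 x + D * u2 x - c * u1 x + fc f c \<tau> (seg (c * \<tau>) \<phi> x) = 0" for x
    using eq[of x] by (simp add: Hop_def)
  ultimately show ?thesis
    by (simp add: W_solution_def W_lhs_def numeral_3_eq_3 numeral_2_eq_2)
qed

lemma Gam_le:
  assumes "\<phi> \<in> Gam K"
  shows "\<phi> x \<le> K"
proof -
  have "mono \<phi>" "(\<phi> \<longlongrightarrow> K) at_top"
    using assms by (auto simp: Gam_def)
  then show ?thesis
    by (intro tendsto_lowerbound[of \<phi> K at_top])
      (auto simp: eventually_at_top_linorder monoD intro!: exI[of _ x])
qed

text \<open>The sets where the gap is below \<open>\<epsilon>\<close> form an open cover that grows
  with \<open>n\<close>, so the largest index of a finite subcover works.\<close>

lemma Dini_decreasing: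
  fixes F :: "nat \<Rightarrow> 'a::topological_space \<Rightarrow> real"
  assumes "compact S" and F: "\<And>n. continuous_on UNIV (F n)" and g: "continuous_on UNIV g"
    and dec: "\<And>x. decseq (\<lambda>n. F n x)" and lim: "\<And>x. (\<lambda>n. F n x) \<longlonglongrightarrow> g x" and "\<epsilon> > 0"
  obtains N where "\<And>n x. N \<le> n \<Longrightarrow> x \<in> S \<Longrightarrow> F n x - g x < \<epsilon>"
proof -
  have "open {x. F n x - g x < \<epsilon>}" for n
    by (intro open_Collect_less continuous_intros F g)
  moreover have "S \<subseteq> (\<Union>n. {x. F n x - g x < \<epsilon>})"
  proof
    fix x
    have "\<forall>\<^sub>F n in sequentially. F n x < g x + \<epsilon>"
      using order_tendstoD(2)[OF lim[of x]] \<open>\<epsilon> > 0\<close> by simp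
    then obtain n where "F n x < g x + \<epsilon>"
      by (auto simp: eventually_sequentially)
    then show "x \<in> (\<Union>n. {x. F n x - g x < \<epsilon>})"
      by (auto simp: algebra_simps)
  qed
  ultimately obtain I where I: "finite I" "S \<subseteq> (\<Union>n\<in>I. {x. F n x - g x < \<epsilon>})"
    using compactE_image[OF \<open>compact S\<close>, of UNIV "\<lambda>n. {x. F n x - g x < \<epsilon>}"] by auto
  show thesis
  proof
    \<comment> \<open>Inserting 0 keeps the maximum meaningful when the subcover is empty.\<close>
    fix n x assume n: "Max (insert 0 I) \<le> n" and "x \<in> S"
    then obtain i where i: "i \<in> I" "F i x - g x < \<epsilon>"
      using I(2) by auto
    have "i \<le> Max (insert 0 I)"
      using I(1) i(1) by (intro Max_ge) auto
    then have "i \<le> n"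
      using n by (rule order_trans)
    then show "F n x - g x < \<epsilon>"
      using decseqD[OF dec, of i n x] i(2) by linarith
  qed
qed

lemma Lipschitz_continuous:
  fixes g :: "real \<Rightarrow> real"
  assumes "\<And>x y. \<bar>g x - g y\<bar> \<le> C * \<bar>x - y\<bar>"
  shows "continuous_on UNIV g"
proof (rule lipschitz_on_continuous_on)
  \<comment> \<open>\<open>lipschitz_on\<close> demands a nonnegative constant, so \<open>C\<close>
    is replaced by its absolute value.\<close>
  have "\<bar>C\<bar> * \<bar>x - y\<bar> \<ge> C * \<bar>x - y\<bar>" for x y :: real
    by (intro mult_right_mono) auto
  then show "\<bar>C\<bar>-lipschitz_on UNIV g"
    using assms by (intro lipschitz_onI) (auto simp: dist_real_def intro: order_trans[OF assms])
qed

theorem theorem3p10: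
  fixes c D \<tau> K \<beta> :: real
    and f :: "(real \<Rightarrow> real) \<Rightarrow> real"
    and G \<phi>_up \<phi>_low :: "real \<Rightarrow> real"
  assumes "c > 0" and "D > 0" and "\<tau> > 0"
    and "continuous_map (mtopology_of (BC {-\<tau>..0})) euclideanreal f"
    and "cond_C1 f \<tau> K" and "cond_C2 f c \<tau> K \<beta>" and "cond_C3 f c \<tau> K \<beta>"
    and "is_Green_function c D \<beta> G" and "\<forall>x. - G x \<ge> 0"
    and "\<phi>_up \<in> Gam K" and "W_upper_solution f c D \<tau> \<phi>_up"
    and "\<phi>_low \<in> Gam K" and "W_lower_solution f c D \<tau> \<phi>_low"
    and "\<forall>t. 0 \<le> \<phi>_low t \<and> \<phi>_low t \<le> \<phi>_up t"
  shows "\<exists>\<phi>\<in>Gam K. W_solution f c D \<tau> \<phi> \<and> (\<forall>t. \<phi>_low t \<le> \<phi> t \<and> \<phi> t \<le> \<phi>_up t)"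
proof -
  note C1 = \<open>cond_C1 f \<tau> K\<close> and C2 = \<open>cond_C2 f c \<tau> K \<beta>\<close> and C3 = \<open>cond_C3 f c \<tau> K \<beta>\<close>
  have "\<beta> > 0"
    using C2 by (simp add: cond_C2_def)
  have "G x \<le> 0" for x
    using assms(9) by (simp add: minus_le_iff)
  then obtain \<mu>1 \<mu>2 \<mu>3 where "real_roots c D \<beta> \<mu>1 \<mu>2 \<mu>3"
    using Green_function_real_roots[OF assms(8) _ \<open>c > 0\<close> \<open>D > 0\<close> \<open>\<beta> > 0\<close>] by blast
  then interpret real_roots c D \<beta> \<mu>1 \<mu>2 \<mu>3 .
  let ?H = "Hop f c \<tau> \<beta>" and ?Lsol = "Lsol c D \<beta>"
  \<comment> \<open>The invariant set of the iteration. Its members inherit the limits 0 and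
    \<open>K\<close> from the two barriers.\<close>
  define P where "P \<psi> \<longleftrightarrow> continuous_on UNIV \<psi> \<and> mono \<psi> \<and> (\<forall>t. \<phi>_low t \<le> \<psi> t \<and> \<psi> t \<le> \<phi>_up t)" for \<psi>
  define T where "T \<psi> = (SOME u. ?Lsol (?H \<psi>) u)" for \<psi>
  have up_lim: "(\<phi>_up \<longlongrightarrow> 0) at_bot" "(\<phi>_up \<longlongrightarrow> K) at_top"
    and low_lim: "(\<phi>_low \<longlongrightarrow> 0) at_bot" "(\<phi>_low \<longlongrightarrow> K) at_top"
    using assms(10,12) by (simp_all add: Gam_def)
  have up_low: "P \<phi>_up" "P \<phi>_low"
    using assms(10,12,14) by (auto simp: P_def Gam_def)
  have P_cont: "continuous_on UNIV \<psi>" if "P \<psi>" for \<psi>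
    using that by (simp add: P_def)
  have P_range: "0 \<le> \<psi> t" "\<psi> t \<le> K" if "P \<psi>" for \<psi> t
    using that assms(14) Gam_le[OF assms(10), of t] unfolding P_def by (meson order_trans)+
  have H_mono: "?H \<psi> \<xi> \<le> ?H \<psi>' \<xi>" if "P \<psi>" "P \<psi>'" "\<And>t. \<psi> t \<le> \<psi>' t" for \<psi> \<psi>' \<xi>
    by (rule Hop_mono[OF C2 \<open>c > 0\<close> \<open>\<tau> > 0\<close>]) (use that P_cont P_range in auto)
  have H_range: "\<bar>?H \<psi> \<xi>\<bar> \<le> \<beta> * K" if "P \<psi>" for \<psi> \<xi>
    using Hop_range[OF C1 C2 \<open>c > 0\<close> \<open>\<tau> > 0\<close> P_cont[OF that] P_range[OF that], of \<xi>] by auto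
  have H_cont: "continuous_on UNIV (?H \<psi>)" "bounded (range (?H \<psi>))" if "P \<psi>" for \<psi>
    using Hop_continuous[OF C3 C1 P_cont[OF that] P_range[OF that]] by auto
  have T: "?Lsol (?H \<psi>) (T \<psi>)" if "P \<psi>" for \<psi>
    unfolding T_def using Lsol_exists[OF H_cont[OF that]] by (rule someI_ex)
  have T_up: "T \<psi> x \<le> \<phi>_up x" if "P \<psi>" for \<psi> x
  proof (rule Lsol_mono[OF T[OF that] BC_k_3_Lsol])
    show "BC_k 3 \<phi>_up"
      using assms(11) by (simp add: W_upper_solution_def)
    fix \<xi>
    \<comment> \<open>The right-hand sides are ordered as
      \<open>H(\<psi>) \<le> H(\<phi>_up) \<le> - L \<phi>_up\<close>, the last step being the upper
      solution inequality.\<close>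
    have "?H \<psi> \<xi> \<le> ?H \<phi>_up \<xi>"
      using that by (intro H_mono up_low) (auto simp: P_def)
    then show "?H \<psi> \<xi> \<le> - (c * (deriv ^^ 3) \<phi>_up \<xi> + D * (deriv ^^ 2) \<phi>_up \<xi> - c * deriv \<phi>_up \<xi> - \<beta> * \<phi>_up \<xi>)"
      using assms(11)[unfolded W_upper_solution_def W_lhs_def, THEN conjunct2, THEN spec, of \<xi>]
      by (simp add: Hop_def)
  qed
  have T_low: "\<phi>_low x \<le> T \<psi> x" if "P \<psi>" for \<psi> x
  proof (rule Lsol_mono[OF BC_k_3_Lsol T[OF that]])
    show "BC_k 3 \<phi>_low"
      using assms(13) by (simp add: W_lower_solution_def)
    fix \<xi>
    have "?H \<phi>_low \<xi> \<le> ?H \<psi> \<xi>"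
      using that by (intro H_mono up_low) (auto simp: P_def)
    then show "- (c * (deriv ^^ 3) \<phi>_low \<xi> + D * (deriv ^^ 2) \<phi>_low \<xi> - c * deriv \<phi>_low \<xi> - \<beta> * \<phi>_low \<xi>) \<le> ?H \<psi> \<xi>"
      using assms(13)[unfolded W_lower_solution_def W_lhs_def, THEN conjunct2, THEN spec, of \<xi>]
      by (simp add: Hop_def)
  qed
  have T_mono: "mono (T \<psi>)" if "P \<psi>" for \<psi>
  proof
    fix x y :: real assume "x \<le> y"
    have "T \<psi> x \<le> T \<psi> (x + (y - x))"
    proof (rule Lsol_mono[OF T[OF that] Lsol_shift[OF T[OF that]]])
      fix \<xi>
      have "continuous_on UNIV (\<lambda>t. \<psi> (t + (y - x)))"
        by (rule continuous_on_compose2[OF P_cont[OF that]]) (auto intro!: continuous_intros)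
      \<comment> \<open>A translate of \<open>\<psi>\<close> may rise above \<open>\<phi>_up\<close>
        and leave \<open>P\<close>, but it keeps its values between 0 and \<open>K\<close>; so
        \<open>Hop_mono\<close> is applied directly instead of \<open>H_mono\<close>.\<close>
      then have "?H \<psi> \<xi> \<le> ?H (\<lambda>t. \<psi> (t + (y - x))) \<xi>"
        using that \<open>x \<le> y\<close> P_range[OF that]
        by (intro Hop_mono[OF C2 \<open>c > 0\<close> \<open>\<tau> > 0\<close>]) (auto simp: P_def monoD)
      then show "?H \<psi> \<xi> \<le> ?H \<psi> (\<xi> + (y - x))"
        by (simp only: Hop_shift)
    qed
    then show "T \<psi> x \<le> T \<psi> y" by simp
  qed
  have P_T: "P (T \<psi>)" if "P \<psi>" for \<psi>
    using Lsol_continuous[OF T[OF that]] T_mono T_up T_low that by (auto simp: P_def)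
  define F where "F n = (T ^^ n) \<phi>_up" for n
  have F_Suc: "F (Suc n) = T (F n)" for n
    by (simp add: F_def)
  have P_F: "P (F n)" for n
    by (induction n) (simp_all add: F_def up_low P_T)
  have F_bounds: "\<phi>_low t \<le> F n t" "F n t \<le> \<phi>_up t" for n t
    using P_F[of n] by (auto simp: P_def)
  have F_dec: "F (Suc n) t \<le> F n t" for n t
  proof (induction n arbitrary: t)
    case 0
    then show ?case using F_bounds(2)[of "Suc 0" t] by (simp add: F_def)
  next
    case (Suc n)
    show ?case
      unfolding F_Suc[of "Suc n"] unfolding F_Suc[of n]
      by (rule Lsol_mono[OF T[OF P_T[OF P_F]] T[OF P_F]])
        (use Suc in \<open>auto intro!: H_mono P_F P_T simp: F_Suc\<close>)
  qed
  have dec: "decseq (\<lambda>n. F n t)" for t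
    using F_dec by (simp add: decseq_Suc_iff)
  define \<phi> where "\<phi> t = lim (\<lambda>n. F n t)" for t
  have lim: "(\<lambda>n. F n t) \<longlonglongrightarrow> \<phi> t" for t
  proof -
    have "convergent (\<lambda>n. F n t)"
      using decseq_convergent[OF dec, of "\<phi>_low t" t] F_bounds(1) by (metis convergent_def)
    then show ?thesis
      by (simp add: \<phi>_def convergent_LIMSEQ_iff)
  qed
  have \<phi>_bounds: "\<phi>_low t \<le> \<phi> t" "\<phi> t \<le> \<phi>_up t" for t
    using LIMSEQ_le_const[OF lim] LIMSEQ_le_const2[OF lim] F_bounds by blast+
  have "mono \<phi>"
  proof
    fix x y :: real assume "x \<le> y"
    then have "F n x \<le> F n y" for n
      using P_F[of n] by (auto simp: P_def monoD)
    then show "\<phi> x \<le> \<phi> y"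
      by (intro LIMSEQ_le[OF lim lim]) auto
  qed
  define C where "C = 2 * (\<beta> * K) / (c * \<mu>1 * \<bar>\<mu>2\<bar>)"
  \<comment> \<open>The index starts at 1 because the bound concerns values of \<open>T\<close>, and
    \<open>F 0\<close> is the upper solution itself.\<close>
  have "\<bar>F (Suc n) x - F (Suc n) y\<bar> \<le> C * \<bar>x - y\<bar>" for n x y
    unfolding C_def F_Suc by (rule Lsol_Lipschitz[OF T[OF P_F] H_range[OF P_F]])
  then have "\<bar>\<phi> x - \<phi> y\<bar> \<le> C * \<bar>x - y\<bar>" for x y
    by (intro LIMSEQ_le_const2[OF tendsto_rabs[OF tendsto_diff[OF lim lim, THEN LIMSEQ_Suc]]]) auto
  then have \<phi>_cont: "continuous_on UNIV \<phi>"
    by (rule Lipschitz_continuous)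
  have P_\<phi>: "P \<phi>"
    using \<phi>_cont \<open>mono \<phi>\<close> \<phi>_bounds by (simp add: P_def)
  have \<phi>_lim: "(\<phi> \<longlongrightarrow> 0) at_bot" "(\<phi> \<longlongrightarrow> K) at_top"
    using \<phi>_bounds by (auto intro: tendsto_sandwich[OF _ _ low_lim(1) up_lim(1)]
        tendsto_sandwich[OF _ _ low_lim(2) up_lim(2)])
  \<comment> \<open>Outside a compact interval the gap between the barriers is already below
    \<open>\<epsilon>\<close>; inside it Dini's theorem applies. Two consecutive iterates are
    controlled because \<open>F (Suc n) = T (F n)\<close> is compared with
    \<open>T \<phi>\<close>.\<close>
  have F_unif: "\<exists>n. \<forall>x. \<bar>F n x - \<phi> x\<bar> \<le> \<epsilon> \<and> \<bar>F (Suc n) x - \<phi> x\<bar> \<le> \<epsilon>" if "\<epsilon> > 0" for \<epsilon>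
  proof -
    have "((\<lambda>x. \<phi>_up x - \<phi>_low x) \<longlongrightarrow> 0 - 0) at_bot" "((\<lambda>x. \<phi>_up x - \<phi>_low x) \<longlongrightarrow> K - K) at_top"
      by (rule tendsto_diff[OF up_lim(1) low_lim(1)], rule tendsto_diff[OF up_lim(2) low_lim(2)])
    from order_tendstoD(2)[OF this(1), of \<epsilon>] order_tendstoD(2)[OF this(2), of \<epsilon>] \<open>\<epsilon> > 0\<close>
    obtain a b where a: "\<And>x. x \<le> a \<Longrightarrow> \<phi>_up x - \<phi>_low x < \<epsilon>" and b: "\<And>x. b \<le> x \<Longrightarrow> \<phi>_up x - \<phi>_low x < \<epsilon>"
      by (auto simp: eventually_at_bot_linorder eventually_at_top_linorder)
    obtain N where N: "\<And>n x. N \<le> n \<Longrightarrow> x \<in> {a..b} \<Longrightarrow> F n x - \<phi> x < \<epsilon>"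
      using Dini_decreasing[OF compact_Icc P_cont[OF P_F] \<phi>_cont dec lim \<open>\<epsilon> > 0\<close>] by blast
    have "\<bar>F n x - \<phi> x\<bar> \<le> \<epsilon>" if "N \<le> n" for n x
    proof -
      have "\<phi> x \<le> F n x"
        by (rule decseq_ge[OF dec lim])
      moreover have "F n x - \<phi> x \<le> \<phi>_up x - \<phi>_low x"
        using F_bounds(2)[of n x] \<phi>_bounds(1)[of x] by linarith
      ultimately show ?thesis
        using N[OF that, of x] a[of x] b[of x] by (cases "x \<in> {a..b}") force+
    qed
    then show ?thesis
      by (meson le_SucI order_refl)
  qed
  obtain L where L: "L > 0" "\<And>\<phi> \<psi> k \<xi>. continuous_on UNIV \<phi> \<Longrightarrow> continuous_on UNIV \<psi> \<Longrightarrow>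
    (\<And>x. \<bar>\<phi> x - \<psi> x\<bar> \<le> k) \<Longrightarrow> \<bar>?H \<phi> \<xi> - ?H \<psi> \<xi>\<bar> \<le> L * k"
    using Hop_Lipschitz[OF C2 \<open>c > 0\<close> \<open>\<tau> > 0\<close>] by metis
  have "\<phi> x = T \<phi> x" for x
  proof (rule ccontr)
    assume neq: "\<phi> x \<noteq> T \<phi> x"
    \<comment> \<open>\<open>m * \<epsilon>\<close> bounds the distance from \<open>\<phi> x\<close>
      to \<open>T \<phi> x\<close>: one \<open>\<epsilon>\<close> for \<open>F (Suc n)\<close>
      against \<open>\<phi>\<close>, and \<open>L / \<beta> * \<epsilon>\<close> for
      \<open>T (F n)\<close> against \<open>T \<phi>\<close>. The choice of
      \<open>\<epsilon>\<close> makes this half the distance.\<close>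
    define m where "m = 1 + L / \<beta>"
    define \<epsilon> where "\<epsilon> = \<bar>\<phi> x - T \<phi> x\<bar> / (2 * m)"
    have pos: "m > 0"
      using L(1) \<open>\<beta> > 0\<close> by (simp add: m_def add_pos_pos)
    then have "\<epsilon> > 0"
      using neq by (simp add: \<epsilon>_def)
    then obtain n where n: "\<And>x. \<bar>F n x - \<phi> x\<bar> \<le> \<epsilon>" "\<And>x. \<bar>F (Suc n) x - \<phi> x\<bar> \<le> \<epsilon>"
      using F_unif by blast
    have "\<bar>?H (F n) \<xi> - ?H \<phi> \<xi>\<bar> \<le> \<beta> * (L / \<beta> * \<epsilon>)" for \<xi>
      using L(2)[OF P_cont[OF P_F] \<phi>_cont n(1), of \<xi>] \<open>\<beta> > 0\<close> by simp
    then have "\<bar>F (Suc n) x - T \<phi> x\<bar> \<le> L / \<beta> * \<epsilon>"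
      unfolding F_Suc by (rule Lsol_abs_diff_le[OF T[OF P_F] T[OF P_\<phi>]])
    then have "\<bar>\<phi> x - T \<phi> x\<bar> \<le> m * \<epsilon>"
      using n(2)[of x] by (simp add: m_def algebra_simps)
    also have "\<dots> = \<bar>\<phi> x - T \<phi> x\<bar> / 2"
      using pos by (simp add: \<epsilon>_def)
    finally show False
      using neq by simp
  qed
  then have "T \<phi> = \<phi>" by auto
  then have "W_solution f c D \<tau> \<phi>"
    using T[OF P_\<phi>] Lsol_fixed_point_W_solution[OF _ \<open>c > 0\<close> H_cont(1)[OF P_\<phi>]] by simp
  then show ?thesis
    using \<phi>_cont \<open>mono \<phi>\<close> \<phi>_lim \<phi>_bounds by (auto simp: Gam_def)
qed

end
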